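(* Let \[ A(p,q,v)=\sum_{D}p^{\mathrm{nbp}(D)}q^{\mathrm{sump}(D)}v^{\mathrm{sumv}(D)}, \] the sum running over all non-empty Dyck paths $D$. Equivalently, $A(p,q,v)=\sum_P p^{\mathrm{row}(P)}q^{\mathrm{area}(P)-\mathrm{row}(P)}v^{\mathrm{point}(P)}$ summed over Stanley polyominoes $P$ with at least two columns. Then \[ A(p,q,v)=-1+\cfrac{v}{1+v-pqv-\cfrac{v}{1+v-pq^{2}v^2-\cfrac{v}{1+v-pq^{3}v^3-\cfrac{v}{1+v-\cdots}}}}, \] where the $j$-th partial denominator is $1+v-pq^jv^j$.
   Context: Dyck paths are lattice paths from $(0,0)$ to $(2n,0)$ with steps $u=(1,1)$, $d=(1,-1)$ never going below the $x$-axis. A peak is an occurrence of $ud$ and a valley an occurrence of $du$; its height is the ordinate of the common point of the two steps. $\mathrm{nbp}(D)$ is the number of peaks, $\mathrm{sump}(D)$ the sum of peak heights, $\mathrm{sumv}(D)$ the sum of valley heights. A Stanley polyomino (up to translation) is a set of unit cells $[i,i+1]\times[j,j+1]$ forming rows $0,\dots,k-1$ (bottom to top), row $j$ consisting of the cells with $s_j\le i\le e_j$, such that $s_{j-1}<s_j\le e_{j-1}<e_j$; $\mathrm{row}(P)=k$, $\mathrm{area}(P)$ is the number of cells, the number of columns is $e_{k-1}-s_0+1$, and $\mathrm{point}(P)$ is the number of lattice points belonging to exactly four cells of $P$. *)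

theory Defs
  imports "HOL-Computational_Algebra.Computational_Algebra"
begin

section \<open>Dyck paths\<close>

datatype step = Up | Down

fun rise :: "step \<Rightarrow> int" where
  "rise Up = 1"
| "rise Down = -1"

text \<open>The ordinate of the path after its first \<open>i\<close> steps.\<close>

definition height :: "step list \<Rightarrow> nat \<Rightarrow> int" where
  "height D i = (\<Sum>x\<leftarrow>take i D. rise x)"

definition dyck_path :: "step list \<Rightarrow> bool" where
  "dyck_path D \<longleftrightarrow> (\<forall>i\<le>length D. height D i \<ge> 0) \<and> height D (length D) = 0"

text \<open>A peak or valley is recorded by the index of the first of its two steps, so the
  common point of the two steps is reached after \<open>i + 1\<close> steps.\<close>

definition peaks :: "step list \<Rightarrow> nat set" where
  "peaks D = {i. i + 1 < length D \<and> D ! i = Up \<and> D ! (i + 1) = Down}"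

definition valleys :: "step list \<Rightarrow> nat set" where
  "valleys D = {i. i + 1 < length D \<and> D ! i = Down \<and> D ! (i + 1) = Up}"

definition nbp :: "step list \<Rightarrow> nat" where
  "nbp D = card (peaks D)"

definition sump :: "step list \<Rightarrow> nat" where
  "sump D = nat (\<Sum>i\<in>peaks D. height D (i + 1))"

definition sumv :: "step list \<Rightarrow> nat" where
  "sumv D = nat (\<Sum>i\<in>valleys D. height D (i + 1))"


section \<open>Stanley polyominoes\<close>

text \<open>The pair \<open>(i, j)\<close> stands for the unit cell \<open>[i, i+1] \<times> [j, j+1]\<close>.\<close>

type_synonym cell = "int \<times> int"

definition stanley_rows :: "nat \<Rightarrow> (nat \<Rightarrow> int) \<Rightarrow> (nat \<Rightarrow> int) \<Rightarrow> bool" where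
  "stanley_rows k s e \<longleftrightarrow> k \<ge> 1 \<and> (\<forall>j<k. s j \<le> e j) \<and>
     (\<forall>j. 1 \<le> j \<and> j < k \<longrightarrow> s (j - 1) < s j \<and> s j \<le> e (j - 1) \<and> e (j - 1) < e j)"

definition cells :: "nat \<Rightarrow> (nat \<Rightarrow> int) \<Rightarrow> (nat \<Rightarrow> int) \<Rightarrow> cell set" where
  "cells k s e = {(i, int j) |i j. j < k \<and> s j \<le> i \<and> i \<le> e j}"

text \<open>Each translation class is represented by its unique member whose bottom row is row
  \<open>0\<close> and starts at abscissa \<open>0\<close>.\<close>

definition stanley_polyomino :: "cell set \<Rightarrow> bool" where
  "stanley_polyomino P \<longleftrightarrow> (\<exists>k s e. stanley_rows k s e \<and> s 0 = 0 \<and> P = cells k s e)"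

definition row :: "cell set \<Rightarrow> nat" where
  "row P = card (snd ` P)"

definition col :: "cell set \<Rightarrow> nat" where
  "col P = card (fst ` P)"

definition area :: "cell set \<Rightarrow> nat" where
  "area P = card P"

definition point :: "cell set \<Rightarrow> nat" where
  "point P = card {(x, y). card {(i, j) \<in> P. x \<in> {i..i+1} \<and> y \<in> {j..j+1}} = 4}"


section \<open>Generating functions\<close>

text \<open>The coefficient of \<open>p\<^sup>a q\<^sup>b\<close> in \<open>A(p,q,v)\<close> is a polynomial in \<open>v\<close>, so \<open>A(p,q,v)\<close> is a
  formal power series in \<open>p\<close> and \<open>q\<close> over \<open>\<rat>[v]\<close>. We work over the larger field
  \<open>\<rat>((1/v))\<close>, because the partial numerators of the continued fraction are all equal to
  \<open>v\<close>, and it is in powers of \<open>1/v\<close> that it converges to \<open>A(p,q,v)\<close>: for \<open>p = 0\<close>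
  its convergents are \<open>v (1 - v\<^sup>n) / (1 - v\<^sup>n\<^sup>+\<^sup>1)\<close>, which tend to \<open>1\<close> in \<open>\<rat>((1/v))\<close>,
  as required by \<open>A(0,q,v) = 0\<close>, but tend to \<open>v\<close> in \<open>\<rat>((v))\<close>.

  Accordingly, the variable of the Laurent series is \<open>1/v\<close>, that of the inner power series is
  \<open>q\<close> and that of the outer one is \<open>p\<close>.\<close>

type_synonym series = "rat fls fps fps"

definition var_p :: series where
  "var_p = fps_X"

definition var_q :: series where
  "var_q = fps_const fps_X"

definition var_v :: series where
  "var_v = fps_const (fps_const fls_X_inv)"

text \<open>\<open>\<Sum>\<^sub>x\<^sub>\<in>\<^sub>S p\<^sup>f\<^sup>x q\<^sup>g\<^sup>x v\<^sup>h\<^sup>x\<close>, for \<open>S\<close> containing finitely many \<open>x\<close> with given \<open>f x\<close> and \<open>g x\<close>;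
  see \<open>finite_dyck\<close> and \<open>finite_stanley\<close> below.\<close>

definition genfun :: "'a set \<Rightarrow> ('a \<Rightarrow> nat) \<Rightarrow> ('a \<Rightarrow> nat) \<Rightarrow> ('a \<Rightarrow> nat) \<Rightarrow> series" where
  "genfun S f g h =
     Abs_fps (\<lambda>a. Abs_fps (\<lambda>b. \<Sum>x\<in>{x \<in> S. f x = a \<and> g x = b}. fls_X_inv ^ h x))"

definition A_dyck :: series where
  "A_dyck = genfun {D. dyck_path D \<and> D \<noteq> []} nbp sump sumv"

definition A_stanley :: series where
  "A_stanley = genfun {P. stanley_polyomino P \<and> col P \<ge> 2} row (\<lambda>P. area P - row P) point"


section \<open>The continued fraction\<close>

text \<open>The finite continued fraction with the \<open>n\<close> partial denominators numbered
  \<open>j, \<dots>, j + n - 1\<close>. Division of power series is exact here, since every denominator is a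
  unit; see \<open>cfrac_Suc_mult\<close> below.\<close>

primrec cfrac :: "series \<Rightarrow> series \<Rightarrow> series \<Rightarrow> nat \<Rightarrow> nat \<Rightarrow> series" where
  "cfrac p q v j 0 = 0"
| "cfrac p q v j (Suc n) = v / (1 + v - p * q ^ j * v ^ j - cfrac p q v (Suc j) n)"


section \<open>Well-definedness\<close>

lemma peaks_snoc:
  "peaks (D @ [x]) = peaks D \<union> (if D \<noteq> [] \<and> last D = Up \<and> x = Down then {length D - 1} else {})"
  by (cases D rule: rev_cases)
    (auto simp: peaks_def nth_append last_conv_nth less_Suc_eq split: if_splits)

lemma valleys_snoc:
  "valleys (D @ [x]) = valleys D \<union> (if D \<noteq> [] \<and> last D = Down \<and> x = Up then {length D - 1} else {})"
  by (cases D rule: rev_cases)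
    (auto simp: valleys_def nth_append last_conv_nth less_Suc_eq split: if_splits)

lemma finite_peaks [simp]: "finite (peaks D)"
  by (rule finite_subset[of _ "{..<length D}"]) (auto simp: peaks_def)

lemma finite_valleys [simp]: "finite (valleys D)"
  by (rule finite_subset[of _ "{..<length D}"]) (auto simp: valleys_def)

lemma height_snoc: "i \<le> length D \<Longrightarrow> height (D @ [x]) i = height D i"
  by (simp add: height_def)

lemma peak_valley_sums:
  "(\<Sum>i\<in>peaks D. height D (i + 1)) - (\<Sum>i\<in>valleys D. height D (i + 1)) =
     int (length (filter (\<lambda>x. x = Up) D)) -
     (if D \<noteq> [] \<and> last D = Up then height D (length D) else 0)"
proof (induction D rule: rev_induct)
  case Nil
  then show ?case by (simp add: peaks_def valleys_def)
next
  case (snoc x D)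
  have P: "(\<Sum>i\<in>peaks D. height (D @ [x]) (i + 1)) = (\<Sum>i\<in>peaks D. height D (i + 1))"
    by (rule sum.cong) (auto simp: peaks_def height_snoc)
  have V: "(\<Sum>i\<in>valleys D. height (D @ [x]) (i + 1)) = (\<Sum>i\<in>valleys D. height D (i + 1))"
    by (rule sum.cong) (auto simp: valleys_def height_snoc)
  have nP: "length D - Suc 0 \<notin> peaks D" and nV: "length D - Suc 0 \<notin> valleys D"
    by (auto simp: peaks_def valleys_def)
  have L: "height (D @ [x]) (Suc (length D)) = height D (length D) + rise x"
    by (simp add: height_def)
  have S: "peaks [y] = {}" "valleys [y] = {}" for y
    by (auto simp: peaks_def valleys_def)
  show ?case
    using snoc P V nP nV L
    by (cases x; cases "D = []"; cases "last D")
      (auto simp: peaks_snoc valleys_snoc height_snoc height_def[of "[]"] S)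
qed

lemma sump_eq_semilength_plus_sumv:
  assumes "dyck_path D"
  shows "2 * sump D = length D + 2 * sumv D"
proof -
  have c: "height E (length E) =
      2 * int (length (filter (\<lambda>x. x = Up) E)) - int (length E)" for E
  proof (induction E)
    case (Cons x E)
    then show ?case by (cases x) (auto simp: height_def)
  qed (simp add: height_def)
  have "\<not> (D \<noteq> [] \<and> last D = Up)"
  proof
    assume *: "D \<noteq> [] \<and> last D = Up"
    then obtain E where E: "D = E @ [Up]" by (metis append_butlast_last_id)
    then have "height D (length E) + 1 = height D (length D)"
      by (simp add: height_def)
    moreover have "height D (length E) \<ge> 0"
      using assms E by (auto simp: dyck_path_def)
    ultimately show False using assms by (simp add: dyck_path_def)
  qed
  then have "(\<Sum>i\<in>peaks D. height D (i + 1)) - (\<Sum>i\<in>valleys D. height D (i + 1)) =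
     int (length (filter (\<lambda>x. x = Up) D))"
    using peak_valley_sums[of D] by auto
  moreover have "(\<Sum>i\<in>peaks D. height D (i + 1)) \<ge> 0"
    by (rule sum_nonneg) (use assms in \<open>auto simp: dyck_path_def peaks_def\<close>)
  moreover have "(\<Sum>i\<in>valleys D. height D (i + 1)) \<ge> 0"
    by (rule sum_nonneg) (use assms in \<open>auto simp: dyck_path_def valleys_def\<close>)
  moreover have "2 * int (length (filter (\<lambda>x. x = Up) D)) = int (length D)"
    using c[of D] assms by (simp add: dyck_path_def)
  ultimately show ?thesis unfolding sump_def sumv_def by linarith
qed

lemma finite_dyck: "finite {D \<in> {D. dyck_path D \<and> D \<noteq> []}. nbp D = a \<and> sump D = b}"
proof (rule finite_subset)
  show "{D \<in> {D. dyck_path D \<and> D \<noteq> []}. nbp D = a \<and> sump D = b} \<subseteq>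
      {D. set D \<subseteq> {Up, Down} \<and> length D \<le> 2 * b}"
  proof
    fix D assume "D \<in> {D \<in> {D. dyck_path D \<and> D \<noteq> []}. nbp D = a \<and> sump D = b}"
    then have "length D \<le> 2 * b"
      using sump_eq_semilength_plus_sumv[of D] by auto
    moreover have "set D \<subseteq> {Up, Down}" using step.exhaust by blast
    ultimately show "D \<in> {D. set D \<subseteq> {Up, Down} \<and> length D \<le> 2 * b}" by simp
  qed
qed (rule finite_lists_length_le, simp)

lemma finite_cells [simp]: "finite (cells k s e)"
proof (rule finite_subset)
  show "cells k s e \<subseteq> (\<Union>j<k. {s j..e j} \<times> {int j})" by (auto simp: cells_def)
qed auto

lemma row_cells:
  assumes "stanley_rows k s e"
  shows "snd ` cells k s e = int ` {..<k}"
  using assms by (force simp: cells_def stanley_rows_def)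

lemma col_cells:
  assumes "stanley_rows k s e"
  shows "fst ` cells k s e = {s 0..e (k - 1)}"
proof -
  have "fst ` cells (Suc n) s e = {s 0..e n} \<and> s 0 \<le> s n" if "n < k" for n
    using that
  proof (induction n)
    case 0
    then show ?case by (force simp: cells_def)
  next
    case (Suc n)
    have "s (Suc n - 1) < s (Suc n) \<and> s (Suc n) \<le> e (Suc n - 1) \<and> e (Suc n - 1) < e (Suc n)"
      using assms Suc.prems unfolding stanley_rows_def by (metis le_add1 plus_1_eq_Suc)
    then have "s n < s (Suc n)" "s (Suc n) \<le> e n" "e n < e (Suc n)" by auto
    moreover have "fst ` cells (Suc (Suc n)) s e =
        fst ` cells (Suc n) s e \<union> {s (Suc n)..e (Suc n)}"
      by (force simp: cells_def less_Suc_eq)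
    ultimately show ?case using Suc by auto
  qed
  from this[of "k - 1"] show ?thesis using assms by (simp add: stanley_rows_def)
qed

lemma row_stanley: "stanley_rows k s e \<Longrightarrow> row (cells k s e) = k"
  by (simp add: row_def row_cells card_image)

lemma col_stanley:
  assumes "stanley_rows k s e"
  shows "int (col (cells k s e)) = e (k - 1) - s 0 + 1"
proof -
  have "k \<ge> 1" using assms by (simp add: stanley_rows_def)
  then have "int 0 \<in> snd ` cells k s e"
    unfolding row_cells[OF assms] by (intro imageI) simp
  then have "fst ` cells k s e \<noteq> {}" by blast
  then have "s 0 \<le> e (k - 1)" unfolding col_cells[OF assms] by simp
  then show ?thesis unfolding col_def col_cells[OF assms] by simp
qed

lemma row_le_area: "stanley_polyomino P \<Longrightarrow> row P \<le> area P"
  by (auto simp: stanley_polyomino_def row_def area_def intro: card_image_le)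

lemma finite_stanley:
  "finite {P \<in> {P. stanley_polyomino P \<and> col P \<ge> 2}. row P = a \<and> area P - row P = b}"
proof (rule finite_subset)
  show "{P \<in> {P. stanley_polyomino P \<and> col P \<ge> 2}. row P = a \<and> area P - row P = b} \<subseteq>
      Pow ({0..int (a + b)} \<times> {0..int a})"
  proof (rule subsetI)
    fix P assume "P \<in> {P \<in> {P. stanley_polyomino P \<and> col P \<ge> 2}. row P = a \<and> area P - row P = b}"
    then have P: "stanley_polyomino P" "row P = a" "area P - row P = b" by auto
    then obtain k s e where k: "stanley_rows k s e" "s 0 = 0" "P = cells k s e"
      by (auto simp: stanley_polyomino_def)
    have "col P \<le> area P" using k by (auto simp: col_def area_def intro: card_image_le)
    then have "e (k - 1) \<le> int (a + b)"
      using col_stanley[OF k(1)] k(2) P(2,3) row_le_area[OF P(1)]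
      unfolding k(3)[symmetric] by linarith
    moreover have "fst ` P = {0..e (k - 1)}" "snd ` P = int ` {..<a}"
      using col_cells[OF k(1)] row_cells[OF k(1)] row_stanley[OF k(1)] k P by auto
    ultimately have "fst ` P \<subseteq> {0..int (a + b)}" "snd ` P \<subseteq> {0..int a}" by auto
    then have "P \<subseteq> {0..int (a + b)} \<times> {0..int a}" by force
    then show "P \<in> Pow ({0..int (a + b)} \<times> {0..int a})" by blast
  qed
qed auto

lemma fps_mult_inverse_general:
  fixes f :: "'a :: {comm_ring_1, inverse} fps"
  assumes "f $ 0 * inverse (f $ 0) = 1"
  shows "f * inverse f = 1"
  using fps_right_inverse[OF assms] by (simp add: fps_inverse_def)

lemma fps_divide_mult_general:
  fixes f g :: "'a :: {comm_ring_1, inverse} fps"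
  assumes "f $ 0 * inverse (f $ 0) = 1"
  shows "(g / f) * f = g" and "(g / f) $ 0 = g $ 0 * inverse (f $ 0)"
proof -
  have "f $ 0 \<noteq> 0" using assms by auto
  then have s: "subdegree f = 0" by simp
  then have d: "g / f = g * inverse f"
    by (simp add: fps_divide_def)
  show "(g / f) * f = g"
    unfolding d using fps_mult_inverse_general[OF assms]
    by (metis mult.assoc mult.commute mult.right_neutral)
  show "(g / f) $ 0 = g $ 0 * inverse (f $ 0)"
    unfolding d by simp
qed

lemma cfrac_denominator:
  fixes K :: series and j :: nat
  assumes K: "\<forall>i<0. fls_nth (K $ 0 $ 0) i = 0"
  defines "d \<equiv> 1 + var_v - var_p * var_q ^ j * var_v ^ j - K"
  shows "d $ 0 * inverse (d $ 0) = 1"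
    and "\<forall>i<0. fls_nth ((var_v / d) $ 0 $ 0) i = 0"
proof -
  have d0: "d $ 0 $ 0 = 1 + fls_X_inv - K $ 0 $ 0"
    by (simp add: d_def var_p_def var_v_def)
  have c: "fls_nth (d $ 0 $ 0) (-1) = 1"
    using K by (simp add: d0)
  then have nz: "d $ 0 $ 0 \<noteq> 0" by auto
  then show *: "d $ 0 * inverse (d $ 0) = 1"
    using inverse_mult_eq_1[of "d $ 0"] by (simp add: mult.commute)
  have "(var_v / d) $ 0 = var_v $ 0 * inverse (d $ 0)"
    by (rule fps_divide_mult_general(2)[OF *])
  then have e: "(var_v / d) $ 0 $ 0 = fls_X_inv / (d $ 0 $ 0)"
    by (simp add: var_v_def divide_inverse)
  have "fls_subdegree (d $ 0 $ 0) \<le> -1"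
    by (rule fls_subdegree_leI) (simp add: c)
  then have "fls_subdegree ((var_v / d) $ 0 $ 0) \<ge> 0"
    using nz by (simp add: e fls_divide_subdegree)
  then show "\<forall>i<0. fls_nth ((var_v / d) $ 0 $ 0) i = 0"
    by auto
qed

lemma cfrac_Suc_mult:
  "cfrac var_p var_q var_v j (Suc n) *
     (1 + var_v - var_p * var_q ^ j * var_v ^ j - cfrac var_p var_q var_v (Suc j) n) = var_v"
proof -
  have "\<forall>i<0. fls_nth (cfrac var_p var_q var_v j n $ 0 $ 0) i = 0" for j
    by (induction n arbitrary: j) (simp_all add: cfrac_denominator(2))
  then show ?thesis
    unfolding cfrac.simps by (intro fps_divide_mult_general(1) cfrac_denominator(1)) blast
qed

end

theory Submission
  imports Defs
begin

text \<open>
  Cutting a non-empty Dyck path at its first return to the axis writes it uniquely as \<open>u l d r\<close>.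
  If \<open>G\<^sub>j\<close> sums \<open>p\<^sup>n\<^sup>b\<^sup>p q\<^sup>s\<^sup>u\<^sup>m\<^sup>p v\<^sup>s\<^sup>u\<^sup>m\<^sup>v\<close> over all Dyck paths with \<open>p\<close> replaced by
  \<open>p (q v)\<^sup>j\<close>, this gives \<open>v (G\<^sub>j - 1) = (p q\<^sup>j\<^sup>+\<^sup>1 v\<^sup>j\<^sup>+\<^sup>1 + G\<^sub>j\<^sub>+\<^sub>1 - 1) G\<^sub>j\<close>, that is,
  \<open>G\<^sub>j = v / (1 + v - p q\<^sup>j\<^sup>+\<^sup>1 v\<^sup>j\<^sup>+\<^sup>1 - G\<^sub>j\<^sub>+\<^sub>1)\<close>. Replacing \<open>G\<^sub>j\<^sub>+\<^sub>1\<close> by an approximation multiplies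
  the error by \<open>1/v\<close> times two series whose coefficient of \<open>p\<^sup>a q\<^sup>b\<close> has degree at most \<open>b\<close>
  in \<open>v\<close>, so the convergents tend to \<open>G\<^sub>0 = 1 + A\<close>.

  A Dyck path \<open>u\<^sup>x d\<^sup>y u\<^sup>x\<^sup>' d\<^sup>y\<^sup>' \<dots>\<close> corresponds to the polyomino whose row ends are the partial sums of
  the \<open>x\<close> and whose row starts are those of the \<open>y\<close>: the \<open>j\<close>-th peak height is the length of row
  \<open>j\<close> minus one, and the \<open>j\<close>-th valley height is the number of interior lattice points
  between two consecutive rows.
\<close>

section \<open>Generating functions\<close>

lemma genfun_nth: "genfun S f g h $ a $ b = (\<Sum>x\<in>{x \<in> S. f x = a \<and> g x = b}. fls_X_inv ^ h x)"
  by (simp add: genfun_def)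

lemma monomial_eq: "var_p ^ a * var_q ^ b * var_v ^ c =
    fps_X ^ a * fps_const (fps_X ^ b * fps_const (fls_X_inv ^ c))"
  by (simp add: var_p_def var_q_def var_v_def fps_const_power mult.assoc)

lemma monomial_nth: "(var_p ^ a * var_q ^ b * var_v ^ c) $ a' $ b' =
    (if a' = a \<and> b' = b then fls_X_inv ^ c else 0)"
  unfolding monomial_eq by (auto simp: fps_X_power_mult_nth)

text \<open>The finiteness hypothesis matters because a sum over an infinite set is 0 by convention,
  and a new element would then leave the coefficient unchanged.\<close>

lemma genfun_insert:
  assumes "x \<notin> S" and "\<And>a b. finite {y \<in> S. f y = a \<and> g y = b}"
  shows "genfun (insert x S) f g h = var_p ^ f x * var_q ^ g x * var_v ^ h x + genfun S f g h"
proof (intro fps_ext)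
  fix a b
  have "{y \<in> insert x S. f y = a \<and> g y = b} =
      (if f x = a \<and> g x = b then insert x {y \<in> S. f y = a \<and> g y = b} else {y \<in> S. f y = a \<and> g y = b})"
    by auto
  then show "genfun (insert x S) f g h $ a $ b =
      (var_p ^ f x * var_q ^ g x * var_v ^ h x + genfun S f g h) $ a $ b"
    using assms by (auto simp: genfun_nth monomial_nth)
qed

text \<open>\<open>\<phi>\<close> restricts to a bijection between the fibres with prescribed
  exponents, so the coefficients agree.\<close>

lemma genfun_reindex:
  assumes "bij_betw \<phi> S T"
    and "\<And>x. x \<in> S \<Longrightarrow> f' (\<phi> x) = f x" "\<And>x. x \<in> S \<Longrightarrow> g' (\<phi> x) = g x"
    and "\<And>x. x \<in> S \<Longrightarrow> h' (\<phi> x) = h x"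
  shows "genfun T f' g' h' = genfun S f g h"
proof (intro fps_ext)
  fix a b
  have "bij_betw \<phi> {x \<in> S. f x = a \<and> g x = b} (\<phi> ` {x \<in> S. f x = a \<and> g x = b})"
    by (rule bij_betw_subset[OF assms(1)]) auto
  moreover have "\<phi> ` {x \<in> S. f x = a \<and> g x = b} = {x \<in> T. f' x = a \<and> g' x = b}"
    using bij_betw_imp_surj_on[OF assms(1)] assms(2,3) by force
  ultimately have "bij_betw \<phi> {x \<in> S. f x = a \<and> g x = b} {x \<in> T. f' x = a \<and> g' x = b}"
    by simp
  from sum.reindex_bij_betw[OF this, of "\<lambda>x. (fls_X_inv :: rat fls) ^ h' x"]
  show "genfun T f' g' h' $ a $ b = genfun S f g h $ a $ b"
    unfolding genfun_nth using assms(4) by simp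
qed

text \<open>The Cauchy product sorts the pairs of \<open>S \<times> T\<close> by the two exponents
  of their first component.\<close>

lemma genfun_times:
  assumes S: "\<And>a b. finite {x \<in> S. f x = a \<and> g x = b}"
    and T: "\<And>a b. finite {x \<in> T. f' x = a \<and> g' x = b}"
  shows "genfun S f g h * genfun T f' g' h' =
    genfun (S \<times> T) (\<lambda>(x, y). f x + f' y) (\<lambda>(x, y). g x + g' y) (\<lambda>(x, y). h x + h' y)"
proof (intro fps_ext)
  fix a b
  let ?S = "\<lambda>i j. {x \<in> S. f x = i \<and> g x = j}"
  let ?T = "\<lambda>i j. {x \<in> T. f' x = i \<and> g' x = j}"
  let ?Z = "{z \<in> S \<times> T. (\<lambda>(x, y). f x + f' y) z = a \<and> (\<lambda>(x, y). g x + g' y) z = b}"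
  let ?F = "\<lambda>z. (fls_X_inv :: rat fls) ^ (\<lambda>(x, y). h x + h' y) z"
  let ?k = "\<lambda>z. (f (fst z), g (fst z))"
  \<comment> \<open>The two bounds make the truncated subtractions exact.\<close>
  have fib: "{z \<in> ?Z. ?k z = (i, j)} = ?S i j \<times> ?T (a - i) (b - j)" if "i \<le> a" "j \<le> b" for i j
    using that by auto
  have "?Z \<subseteq> (\<Union>i\<in>{0..a}. \<Union>j\<in>{0..b}. ?S i j \<times> ?T (a - i) (b - j))"
    by auto
  then have fin: "finite ?Z"
    by (rule finite_subset) (use S T in auto)
  have "(genfun S f g h * genfun T f' g' h') $ a $ b =
      (\<Sum>i=0..a. \<Sum>j=0..b. \<Sum>z\<in>?S i j \<times> ?T (a - i) (b - j). ?F z)"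
    by (simp add: fps_mult_nth fps_sum_nth genfun_nth sum_product sum.cartesian_product power_add case_prod_unfold)
  also have "\<dots> = (\<Sum>k\<in>{0..a}\<times>{0..b}. \<Sum>z\<in>{z \<in> ?Z. ?k z = k}. ?F z)"
    unfolding sum.cartesian_product using fib
    by (intro sum.cong) auto
  also have "\<dots> = (\<Sum>z\<in>?Z. ?F z)"
    by (rule sum.group) (use fin in auto)
  finally show "(genfun S f g h * genfun T f' g' h') $ a $ b =
      genfun (S \<times> T) (\<lambda>(x, y). f x + f' y) (\<lambda>(x, y). g x + g' y) (\<lambda>(x, y). h x + h' y) $ a $ b"
    unfolding genfun_nth .
qed

lemma var_v_times_genfun: "var_v * genfun S f g h = genfun S f g (\<lambda>x. 1 + h x)"
  by (intro fps_ext) (simp add: var_v_def genfun_nth sum_distrib_left)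

lemma genfun_cong:
  assumes "\<And>x. x \<in> S \<Longrightarrow> f x = f' x \<and> g x = g' x \<and> h x = h' x"
  shows "genfun S f g h = genfun S f' g' h'"
  by (intro fps_ext) (use assms in \<open>auto simp: genfun_nth intro!: sum.cong\<close>)

section \<open>Convergence of the continued fraction\<close>

text \<open>As the variable is \<open>1/v\<close>, this says that \<open>f\<close> has degree at most \<open>- m\<close> in \<open>v\<close>.\<close>

definition vanishes_below :: "int \<Rightarrow> rat fls \<Rightarrow> bool" where
  "vanishes_below m f \<longleftrightarrow> (\<forall>i<m. fls_nth f i = 0)"

lemma vanishes_below_simps [simp]:
  "vanishes_below m 0"
  "vanishes_below m f \<Longrightarrow> vanishes_below m g \<Longrightarrow> vanishes_below m (f + g)"
  "vanishes_below m f \<Longrightarrow> vanishes_below m g \<Longrightarrow> vanishes_below m (f - g)"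
  by (auto simp: vanishes_below_def)

lemma vanishes_below_sum:
  "(\<And>x. x \<in> S \<Longrightarrow> vanishes_below m (f x)) \<Longrightarrow> vanishes_below m (\<Sum>x\<in>S. f x)"
  by (auto simp: vanishes_below_def fls_nth_sum)

text \<open>In each term of the convolution at least one of the two indices lies below its
  bound.\<close>

lemma vanishes_below_mult:
  assumes "vanishes_below m f" "vanishes_below n g"
  shows "vanishes_below (m + n) (f * g)"
  unfolding vanishes_below_def
proof (intro allI impI)
  fix i assume "i < m + n"
  have *: "fls_nth f l * fls_nth g (i - l) = 0" for l
  proof (cases "l < m")
    case False
    with \<open>i < m + n\<close> have "i - l < n" by simp
    with assms show ?thesis by (simp add: vanishes_below_def)
  qed (use assms in \<open>simp add: vanishes_below_def\<close>)
  show "fls_nth (f * g) i = 0"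
    by (simp only: fls_times_nth(2) * sum.neutral_const)
qed

text \<open>Distinct Laurent series whose difference has subdegree \<open>d \<ge> 0\<close> are at
  distance \<open>2 ^ (- d)\<close>, and here the subdegree grows at least linearly.\<close>

lemma tendsto_fls_if_vanishes_below:
  assumes "\<And>n. vanishes_below (int n - c) (f n - l)"
  shows "f \<longlonglongrightarrow> l"
proof (rule metric_LIMSEQ_I)
  fix r :: real assume "r > 0"
  obtain N where N: "inverse (2 ^ N) < r"
    using \<open>r > 0\<close> real_arch_pow_inv[of r "1/2"] by (auto simp: power_one_over inverse_eq_divide)
  show "\<exists>no. \<forall>n\<ge>no. dist (f n) l < r"
  proof (intro exI allI impI)
    \<comment> \<open>The summand \<open>nat \<bar>c\<bar>\<close> absorbs the offset, so
      \<open>int n - c \<ge> int N\<close>.\<close>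
    fix n assume n: "n \<ge> nat \<bar>c\<bar> + N"
    show "dist (f n) l < r"
    proof (cases "f n = l")
      case False
      then have "fls_subdegree (f n - l) \<ge> int N"
        using assms[of n] n
        by (intro fls_subdegree_geI) (auto simp: vanishes_below_def)
      moreover from this have "(2::real) ^ N \<le> 2 ^ nat (fls_subdegree (f n - l))"
        by (intro power_increasing) auto
      then have "inverse (2 ^ nat (fls_subdegree (f n - l))) \<le> (inverse (2 ^ N) :: real)"
        by (intro le_imp_inverse_le) auto
      then have "inverse (2 ^ nat (fls_subdegree (f n - l))) < r"
        using N by (rule order.strict_trans1)
      ultimately show ?thesis
        using False by (simp add: dist_fls_def)
    qed (use \<open>r > 0\<close> in simp)
  qed
qed

text \<open>The coefficient of \<open>p\<^sup>a q\<^sup>b\<close> has degree at most \<open>b - m\<close> in \<open>v\<close>. The restriction to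
  finitely many coefficients is needed in \<open>vdeg_le_upto_fixpoint\<close>, whose proof starts from some
  bound on the degrees in \<open>v\<close> of the coefficients of \<open>X\<close>.\<close>

definition vdeg_le_upto :: "nat \<Rightarrow> nat \<Rightarrow> int \<Rightarrow> series \<Rightarrow> bool" where
  "vdeg_le_upto A B m X \<longleftrightarrow> (\<forall>a\<le>A. \<forall>b\<le>B. vanishes_below (m - int b) (X $ a $ b))"

lemma vdeg_le_upto_arith:
  "vdeg_le_upto A B m X \<Longrightarrow> vdeg_le_upto A B m Y \<Longrightarrow> vdeg_le_upto A B m (X + Y)"
  "vdeg_le_upto A B m X \<Longrightarrow> vdeg_le_upto A B m Y \<Longrightarrow> vdeg_le_upto A B m (X - Y)"
  "vdeg_le_upto A B m X \<Longrightarrow> m' \<le> m \<Longrightarrow> vdeg_le_upto A B m' X"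
  unfolding vdeg_le_upto_def by (simp_all add: vanishes_below_def)

text \<open>The allowances for the power of \<open>q\<close> add up, \<open>k + (b - k) = b\<close>,
  and a coefficient of the product inside the box involves only coefficients inside the box.\<close>

lemma vdeg_le_upto_mult:
  assumes "vdeg_le_upto A B m X" "vdeg_le_upto A B n Y"
  shows "vdeg_le_upto A B (m + n) (X * Y)"
  unfolding vdeg_le_upto_def
proof (intro allI impI)
  fix a b assume ab: "a \<le> A" "b \<le> B"
  have "vanishes_below (m + n - int b) (X $ i $ k * Y $ (a - i) $ (b - k))"
    if "i \<le> a" "k \<le> b" for i k
  proof -
    have "vanishes_below ((m - int k) + (n - int (b - k))) (X $ i $ k * Y $ (a - i) $ (b - k))"
      using assms ab that by (intro vanishes_below_mult) (simp_all add: vdeg_le_upto_def del: of_nat_diff)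
    then show ?thesis using that by (simp add: of_nat_diff algebra_simps)
  qed
  then show "vanishes_below (m + n - int b) ((X * Y) $ a $ b)"
    by (auto simp: fps_mult_nth fps_sum_nth intro!: vanishes_below_sum)
qed

text \<open>The box holds finitely many coefficients, each of finite subdegree; the sum of the
  absolute values serves as a common bound.\<close>

lemma vdeg_le_upto_slack: "\<exists>L. vdeg_le_upto A B (- int L) X"
proof -
  let ?I = "{..A} \<times> {..B}"
  let ?L = "\<Sum>(a, b)\<in>?I. nat \<bar>fls_subdegree (X $ a $ b)\<bar>"
  have "nat \<bar>fls_subdegree (X $ a $ b)\<bar> \<le> ?L" if "a \<le> A" "b \<le> B" for a b
    using that member_le_sum[of "(a, b)" ?I "\<lambda>(a, b). nat \<bar>fls_subdegree (X $ a $ b)\<bar>"] by simp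
  then have L: "- int ?L \<le> fls_subdegree (X $ a $ b)" if "a \<le> A" "b \<le> B" for a b
    using that by (smt (verit) nat_le_iff)
  have "fls_nth (X $ a $ b) i = 0" if "a \<le> A" "b \<le> B" "i < - int ?L - int b" for a b i
    by (rule fls_eq0_below_subdegree) (use L[of a b] that in linarith)
  then have "vdeg_le_upto A B (- int ?L) X"
    unfolding vdeg_le_upto_def vanishes_below_def by blast
  then show ?thesis ..
qed

text \<open>Bootstrapping: inserting a bound for \<open>X\<close> into \<open>X = Y - X * W\<close>
  improves it by one, since \<open>W\<close> gains one. After finitely many rounds the initial slack
  is gone.\<close>

lemma vdeg_le_upto_fixpoint:
  assumes Y: "vdeg_le_upto A B 0 Y" and W: "vdeg_le_upto A B 1 W" and X: "X * (1 + W) = Y"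
  shows "vdeg_le_upto A B 0 X"
proof -
  have XY: "X = Y - X * W" using X by (simp add: algebra_simps)
  have "vdeg_le_upto A B 0 X" if "vdeg_le_upto A B (- int L) X" for L
    using that
  proof (induction L)
    case (Suc L)
    have "vdeg_le_upto A B (- int (Suc L) + 1) (X * W)"
      using Suc.prems W by (rule vdeg_le_upto_mult)
    then have "vdeg_le_upto A B (- int L) (Y - X * W)"
      using Y by (intro vdeg_le_upto_arith(2)) (auto intro: vdeg_le_upto_arith(3))
    then show ?case using XY Suc.IH by simp
  qed simp
  then show ?thesis using vdeg_le_upto_slack by blast
qed

definition vdeg_le :: "int \<Rightarrow> series \<Rightarrow> bool" where
  "vdeg_le m X \<longleftrightarrow> (\<forall>a b. vanishes_below (m - int b) (X $ a $ b))"

lemma vdeg_le_iff: "vdeg_le m X \<longleftrightarrow> (\<forall>A B. vdeg_le_upto A B m X)"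
  by (auto simp: vdeg_le_def vdeg_le_upto_def)

lemma vdeg_le_minus: "vdeg_le m X \<Longrightarrow> vdeg_le m Y \<Longrightarrow> vdeg_le m (X - Y)"
  by (simp add: vdeg_le_iff vdeg_le_upto_arith)

lemma vdeg_le_mult: "vdeg_le m X \<Longrightarrow> vdeg_le n Y \<Longrightarrow> vdeg_le (m + n) (X * Y)"
  by (simp add: vdeg_le_iff vdeg_le_upto_mult)

lemma vdeg_le_fixpoint: "vdeg_le 0 Y \<Longrightarrow> vdeg_le 1 W \<Longrightarrow> X * (1 + W) = Y \<Longrightarrow> vdeg_le 0 X"
  unfolding vdeg_le_iff using vdeg_le_upto_fixpoint by blast

lemma vdeg_le_monomial: "c \<le> b \<Longrightarrow> vdeg_le 0 (var_p ^ a * var_q ^ b * var_v ^ c)"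
  by (auto simp: vdeg_le_def monomial_nth vanishes_below_def)

lemma vdeg_le_0: "vdeg_le 0 0" by (simp add: vdeg_le_def)

lemma vdeg_le_1: "vdeg_le 0 1" using vdeg_le_monomial[of 0 0 0] by simp

section \<open>Division by \<open>v\<close> and the error of the convergents\<close>

definition inv_v :: series where
  "inv_v = fps_const (fps_const fls_X)"

lemma inv_v: "inv_v * var_v = 1"
  by (simp add: inv_v_def var_v_def fps_const_mult fls_X_times_conv_shift)

lemma vdeg_le_inv_v: "vdeg_le 1 inv_v"
  by (auto simp: vdeg_le_def vanishes_below_def inv_v_def)

definition cterm :: "nat \<Rightarrow> series" where
  "cterm j = var_p * var_q ^ j * var_v ^ j"

lemma vdeg_le_cterm: "vdeg_le 0 (cterm j)"
  using vdeg_le_monomial[of j j 1] by (simp add: cterm_def)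

text \<open>Division by \<open>v\<close> turns the dominant term \<open>var_v\<close> of the
  denominator into 1 and the rest into a series that gains one, which is the form
  \<open>vdeg_le_fixpoint\<close> asks for.\<close>

lemma vdeg_le_step:
  assumes "C * (1 + var_v - cterm j - C') = var_v" "vdeg_le 0 C'"
  shows "vdeg_le 0 C"
proof (rule vdeg_le_fixpoint[of 1])
  show "vdeg_le 1 (inv_v * (1 - cterm j - C'))"
    using vdeg_le_mult[OF vdeg_le_inv_v, of 0] assms(2) by (simp add: vdeg_le_minus vdeg_le_1 vdeg_le_cterm)
  have "C * (1 + inv_v * (1 - cterm j - C')) = C * (inv_v * var_v + inv_v * (1 - cterm j - C'))"
    by (simp add: inv_v)
  also have "\<dots> = inv_v * (C * (1 + var_v - cterm j - C'))"
    by (simp add: algebra_simps)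
  finally show "C * (1 + inv_v * (1 - cterm j - C')) = 1"
    using assms(1) inv_v by simp
qed (rule vdeg_le_1)

lemma vdeg_le_cfrac: "vdeg_le 0 (cfrac var_p var_q var_v j n)"
proof (induction n arbitrary: j)
  case (Suc n)
  show ?case
    using cfrac_Suc_mult[of j n] Suc.IH[of "Suc j"] vdeg_le_step unfolding cterm_def by blast
qed (simp add: vdeg_le_0)

text \<open>Subtracting the recurrences of \<open>cfrac\<close> and \<open>G\<close> expresses the
  error at one level as \<open>1/v\<close> times two bounded factors times the error at the next
  level. At depth 0 the error is \<open>- G j\<close>.\<close>

lemma cfrac_error:
  assumes G: "\<And>j. G j * (1 + var_v - cterm (Suc j) - G (Suc j)) = var_v"
    and vdeg: "\<And>j. vdeg_le 0 (G j)"
  shows "vdeg_le (int n) (cfrac var_p var_q var_v (Suc j) n - G j)"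
proof (induction n arbitrary: j)
  case 0
  then show ?case using vdeg_le_minus[OF vdeg_le_0 vdeg] by simp
next
  case (Suc n)
  define C where "C = cfrac var_p var_q var_v (Suc j) (Suc n)"
  define C' where "C' = cfrac var_p var_q var_v (Suc (Suc j)) n"
  have C: "C * (1 + var_v - cterm (Suc j) - C') = var_v"
    using cfrac_Suc_mult[of "Suc j" n] by (simp add: C_def C'_def cterm_def)
  \<comment> \<open>Both bracketed products equal \<open>var_v\<close>; written out, their common
    terms cancel and only the difference of the tails survives.\<close>
  have "var_v * (C - G j) =
      C * (G j * (1 + var_v - cterm (Suc j) - G (Suc j))) - (C * (1 + var_v - cterm (Suc j) - C')) * G j"
    unfolding G C by (simp add: algebra_simps)
  also have "\<dots> = C * G j * (C' - G (Suc j))"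
    by (simp add: algebra_simps)
  finally have "inv_v * var_v * (C - G j) = inv_v * (C * G j * (C' - G (Suc j)))"
    by (simp add: mult.assoc)
  then have "C - G j = inv_v * (C * G j * (C' - G (Suc j)))"
    by (simp add: inv_v)
  moreover have "vdeg_le (1 + (0 + 0 + int n)) (inv_v * (C * G j * (C' - G (Suc j))))"
    unfolding C_def C'_def by (intro vdeg_le_mult vdeg_le_inv_v vdeg_le_cfrac vdeg Suc.IH)
  ultimately show ?case by (simp add: C_def)
qed

section \<open>First-return decomposition of Dyck paths\<close>

lemma height_append:
  "height (A @ B) i =
     (if i \<le> length A then height A i else height A (length A) + height B (i - length A))"
  by (simp add: height_def)

lemma height_append_right: "height (A @ B) (length A + i) = height A (length A) + height B i"
  by (simp add: height_def)

lemma height_0 [simp]: "height D 0 = 0"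
  by (simp add: height_def)

lemma height_Cons [simp]: "height (x # D) (Suc i) = rise x + height D i"
  by (simp add: height_def)

section \<open>Weighted sums over peaks and valleys\<close>

definition peak_sum :: "(int \<Rightarrow> int) \<Rightarrow> step list \<Rightarrow> int" where
  "peak_sum \<phi> D = (\<Sum>i\<in>peaks D. \<phi> (height D (i + 1)))"

definition valley_sum :: "(int \<Rightarrow> int) \<Rightarrow> step list \<Rightarrow> int" where
  "valley_sum \<phi> D = (\<Sum>i\<in>valleys D. \<phi> (height D (i + 1)))"

lemma peak_sum_snoc:
  "peak_sum \<phi> (D @ [x]) = peak_sum \<phi> D +
    (if D \<noteq> [] \<and> last D = Up \<and> x = Down then \<phi> (height D (length D)) else 0)"
proof -
  have "(\<Sum>i\<in>peaks D. \<phi> (height (D @ [x]) (i + 1))) = peak_sum \<phi> D"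
    unfolding peak_sum_def by (rule sum.cong) (auto simp: peaks_def height_snoc)
  moreover have "length D - 1 \<notin> peaks D" by (auto simp: peaks_def)
  ultimately show ?thesis
    by (auto simp: peak_sum_def peaks_snoc height_snoc)
qed

lemma valley_sum_snoc:
  "valley_sum \<phi> (D @ [x]) = valley_sum \<phi> D +
    (if D \<noteq> [] \<and> last D = Down \<and> x = Up then \<phi> (height D (length D)) else 0)"
proof -
  have "(\<Sum>i\<in>valleys D. \<phi> (height (D @ [x]) (i + 1))) = valley_sum \<phi> D"
    unfolding valley_sum_def by (rule sum.cong) (auto simp: valleys_def height_snoc)
  moreover have "length D - 1 \<notin> valleys D" by (auto simp: valleys_def)
  ultimately show ?thesis
    by (auto simp: valley_sum_def valleys_snoc height_snoc)
qed

lemma peak_sum_Nil [simp]: "peak_sum \<phi> [] = 0"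
  by (simp add: peak_sum_def peaks_def)

lemma valley_sum_Nil [simp]: "valley_sum \<phi> [] = 0"
  by (simp add: valley_sum_def valleys_def)

lemma peak_sum_single [simp]: "peak_sum \<phi> [x] = 0"
  by (simp add: peak_sum_def peaks_def)

lemma valley_sum_single [simp]: "valley_sum \<phi> [x] = 0"
  by (simp add: valley_sum_def valleys_def)

text \<open>A peak lies in \<open>A\<close>, in \<open>B\<close> lifted by the final height of
  \<open>A\<close>, or across the junction. The arbitrary weight \<open>\<phi>\<close> absorbs the
  lift and treats number and height sum together.\<close>

lemma peak_sum_append:
  "peak_sum \<phi> (A @ B) = peak_sum \<phi> A + peak_sum (\<lambda>y. \<phi> (height A (length A) + y)) B +
    (if A \<noteq> [] \<and> B \<noteq> [] \<and> last A = Up \<and> hd B = Down then \<phi> (height A (length A)) else 0)"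
proof (induction B rule: rev_induct)
  case (snoc x B)
  \<comment> \<open>For empty \<open>B\<close> the new step meets the end of \<open>A\<close> and
    yields the junction term; otherwise any new peak lies inside \<open>B @ [x]\<close>.\<close>
  show ?case
    unfolding append_assoc[symmetric] peak_sum_snoc snoc
    by (cases "B = []") (auto simp: height_append_right peak_sum_snoc)
qed simp

lemma valley_sum_append:
  "valley_sum \<phi> (A @ B) = valley_sum \<phi> A + valley_sum (\<lambda>y. \<phi> (height A (length A) + y)) B +
    (if A \<noteq> [] \<and> B \<noteq> [] \<and> last A = Down \<and> hd B = Up then \<phi> (height A (length A)) else 0)"
proof (induction B rule: rev_induct)
  case (snoc x B)
  show ?case
    unfolding append_assoc[symmetric] valley_sum_snoc snoc
    by (cases "B = []") (auto simp: height_append_right valley_sum_snoc)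
qed simp

lemma peak_sum_add: "peak_sum (\<lambda>y. \<phi> y + \<psi> y) D = peak_sum \<phi> D + peak_sum \<psi> D"
  by (simp add: peak_sum_def sum.distrib)

lemma valley_sum_add: "valley_sum (\<lambda>y. \<phi> y + \<psi> y) D = valley_sum \<phi> D + valley_sum \<psi> D"
  by (simp add: valley_sum_def sum.distrib)

lemma nbp_eq: "int (nbp D) = peak_sum (\<lambda>_. 1) D"
  by (simp add: nbp_def peak_sum_def)

text \<open>Non-negative heights ensure that the \<open>nat\<close> in \<open>sump\<close> loses
  nothing.\<close>

lemma sump_eq:
  assumes "\<And>i. i \<le> length D \<Longrightarrow> height D i \<ge> 0"
  shows "int (sump D) = peak_sum (\<lambda>y. y) D"
proof -
  have "peak_sum (\<lambda>y. y) D \<ge> 0"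
    unfolding peak_sum_def by (rule sum_nonneg) (use assms in \<open>auto simp: peaks_def\<close>)
  then show ?thesis by (simp add: sump_def peak_sum_def)
qed

lemma sumv_eq:
  assumes "\<And>i. i \<le> length D \<Longrightarrow> height D i \<ge> 0"
  shows "int (sumv D) = valley_sum (\<lambda>y. y) D"
proof -
  have "valley_sum (\<lambda>y. y) D \<ge> 0"
    unfolding valley_sum_def by (rule sum_nonneg) (use assms in \<open>auto simp: valleys_def\<close>)
  then show ?thesis by (simp add: sumv_def valley_sum_def)
qed

lemma dyck_path_Nil [simp]: "dyck_path []"
  by (simp add: dyck_path_def)

lemma dyck_path_hd:
  assumes "dyck_path D" "D \<noteq> []"
  shows "hd D = Up"
proof (rule ccontr)
  assume "hd D \<noteq> Up"
  then obtain E where D: "D = Down # E"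
    using assms(2) by (cases D) (auto intro: step.exhaust)
  then have "height D (Suc 0) = -1" by simp
  moreover have "height D (Suc 0) \<ge> 0"
    using assms(1) D by (simp add: dyck_path_def del: height_Cons)
  ultimately show False by simp
qed

lemma dyck_path_last:
  assumes "dyck_path D" "D \<noteq> []"
  shows "last D = Down"
proof (rule ccontr)
  assume "last D \<noteq> Down"
  then have "last D = Up" by (cases "last D") auto
  then obtain E where D: "D = E @ [Up]"
    using assms(2) by (metis append_butlast_last_id)
  then have "height D (length E) + 1 = height D (length D)"
    by (simp add: height_def)
  moreover have "height D (length E) \<ge> 0"
    using assms(1) D by (auto simp: dyck_path_def)
  ultimately show False using assms(1) by (simp add: dyck_path_def)
qed

text \<open>Peaks and valleys alternate, starting with a peak. This lets \<open>nbp\<close> measure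
  how \<open>sumv\<close> changes when a path is lifted.\<close>

lemma valleys_eq_peaks:
  assumes "D \<noteq> [] \<Longrightarrow> hd D = Up"
  shows "valley_sum (\<lambda>_. 1) D = peak_sum (\<lambda>_. 1) D - (if D \<noteq> [] \<and> last D = Down then 1 else 0)"
  using assms
proof (induction D rule: rev_induct)
  case (snoc x D)
  then show ?case
    by (cases x; cases "last D"; cases "D = []") (auto simp: valley_sum_snoc peak_sum_snoc)
qed simp

section \<open>Cutting at the first return\<close>

definition first_return :: "step list \<times> step list \<Rightarrow> step list" where
  "first_return = (\<lambda>(l, r). Up # l @ Down # r)"

lemma height_first_return:
  assumes "height l (length l) = 0"
  shows "height (first_return (l, r)) i =
    (if i = 0 then 0 else if i \<le> Suc (length l) then 1 + height l (i - 1)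
     else height r (i - length l - 2))"
proof (cases i)
  case (Suc n)
  show ?thesis
  proof (cases "n \<le> length l")
    case False
    then obtain m where "n = length l + Suc m" by (metis add_Suc_right less_iff_Suc_add not_le)
    then show ?thesis using assms Suc by (simp add: first_return_def height_append)
  qed (simp add: Suc first_return_def height_append)
qed simp

lemma dyck_path_first_return:
  assumes "dyck_path l" "dyck_path r"
  shows "dyck_path (first_return (l, r))"
proof -
  have l: "height l (length l) = 0" using assms by (simp add: dyck_path_def)
  have len: "length (first_return (l, r)) = length l + length r + 2"
    by (simp add: first_return_def)
  show ?thesis
    unfolding dyck_path_def height_first_return[OF l] len
    using assms by (auto simp: dyck_path_def)
qed

text \<open>One of \<open>l\<close>, \<open>l'\<close> is a prefix of the other. If it were proper,
  the longer path would step down right after the shorter one, from height 0 to below the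
  axis.\<close>

lemma first_return_inj:
  assumes "dyck_path l" "dyck_path l'" "l @ Down # r = l' @ Down # r'"
  shows "l = l' \<and> r = r'"
proof -
  have no: "us = []" if "dyck_path m" "dyck_path m'" "m' = m @ us" "us @ Down # x = Down # y" for us m m' x y
  proof (rule ccontr)
    assume "us \<noteq> []"
    with that(4) obtain us' where "us = Down # us'" by (cases us) auto
    with that(3) have m': "m' = m @ Down # us'" by simp
    then have "height m' (length m + Suc 0) = height m (length m) - 1"
      unfolding m' height_append_right by simp
    moreover have "height m' (length m + Suc 0) \<ge> 0"
      using that(2) m' by (auto simp: dyck_path_def)
    ultimately show False using that(1) by (simp add: dyck_path_def)
  qed
  from assms(3) obtain us where "l = l' @ us \<and> us @ Down # r = Down # r' \<or>
      l' = l @ us \<and> Down # r = us @ Down # r'"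
    by (auto simp: append_eq_append_conv2)
  then have "us = []" using no assms(1,2) by metis
  then show ?thesis using \<open>l = l' @ us \<and> _ \<or> _\<close> by auto
qed

lemma first_return_surj:
  assumes "dyck_path D" "D \<noteq> []"
  shows "\<exists>l r. dyck_path l \<and> dyck_path r \<and> D = first_return (l, r)"
proof -
  obtain E where D: "D = Up # E"
    using dyck_path_hd[OF assms] assms(2) by (cases D) auto
  have E: "height E i \<ge> -1" if "i \<le> length E" for i
  proof -
    have "height D (Suc i) \<ge> 0"
      using assms(1) that by (simp add: dyck_path_def D del: height_Cons)
    then show ?thesis by (simp add: D)
  qed
  have Eend: "height E (length E) = -1"
    using assms(1) by (simp add: dyck_path_def D)
  \<comment> \<open>Dropping the initial \<open>Up\<close> lowers all heights by one, so the first
    return of \<open>D\<close> is the first moment \<open>E\<close> is below 0; it exists because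
    \<open>E\<close> ends at -1.\<close>
  define n where "n = (LEAST i. height E i < 0)"
  have n: "height E n < 0" unfolding n_def by (rule LeastI[of _ "length E"]) (simp add: Eend)
  have nle: "n \<le> length E" unfolding n_def by (rule Least_le) (simp add: Eend)
  have less: "height E i \<ge> 0" if "i < n" for i
    using not_less_Least[of i "\<lambda>i. height E i < 0"] that by (simp add: n_def)
  obtain m where m: "n = Suc m" using n by (cases n) auto
  have split: "E = take m E @ E ! m # drop n E"
    using nle m by (simp add: id_take_nth_drop)
  have hm: "height E (Suc m) = height E m + rise (E ! m)"
    using nle m by (simp add: height_def take_Suc_conv_app_nth)
  have "height E m \<ge> 0" using less m by simp
  \<comment> \<open>A single step leads from a non-negative to a negative height, so it is a
    \<open>Down\<close> starting at height 0.\<close>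
  then have *: "E ! m = Down" "height E m = 0"
    using hm n m by (cases "E ! m"; simp)+
  define l r where "l = take m E" and "r = drop n E"
  have El: "E = l @ Down # r" using split * by (simp add: l_def r_def)
  have lenl: "length l = m" using nle m by (simp add: l_def)
  have hl: "height l i = height E i" if "i \<le> m" for i
    using that by (simp add: height_def l_def min_def)
  have "dyck_path l"
    unfolding dyck_path_def lenl using less m * by (auto simp: hl)
  moreover have hr: "height E (Suc m + i) = height r i - 1" for i
  proof -
    have "height E (Suc m + i) = height E (length l + Suc i)" by (simp add: lenl)
    also have "\<dots> = height l (length l) + height (Down # r) (Suc i)"
      by (subst El) (rule height_append_right)
    finally show ?thesis using * hl by (simp add: lenl)
  qed
  have lenE: "length E = Suc m + length r"
    using El lenl by (metis add_Suc_right add_Suc length_Cons length_append)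
  have "dyck_path r"
    unfolding dyck_path_def
  proof (intro conjI allI impI)
    fix i assume "i \<le> length r"
    then show "height r i \<ge> 0" using E[of "Suc m + i"] hr[of i] lenE by simp
  next
    show "height r (length r) = 0" using Eend hr[of "length r"] lenE by simp
  qed
  ultimately show ?thesis using D El by (auto simp: first_return_def)
qed

lemma bij_first_return:
  "bij_betw first_return ({D. dyck_path D} \<times> {D. dyck_path D}) {D. dyck_path D \<and> D \<noteq> []}"
  unfolding bij_betw_def
proof (intro conjI)
  show "inj_on first_return ({D. dyck_path D} \<times> {D. dyck_path D})"
  proof (rule inj_onI, clarify)
    fix l r l' r'
    assume "dyck_path l" "dyck_path l'" "first_return (l, r) = first_return (l', r')"
    then show "l = l' \<and> r = r'"
      using first_return_inj[of l l' r r'] by (simp add: first_return_def)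
  qed
  show "first_return ` ({D. dyck_path D} \<times> {D. dyck_path D}) = {D. dyck_path D \<and> D \<noteq> []}"
  proof (intro equalityI subsetI)
    fix D assume "D \<in> first_return ` ({D. dyck_path D} \<times> {D. dyck_path D})"
    then obtain l r where "dyck_path l" "dyck_path r" "D = first_return (l, r)" by auto
    then show "D \<in> {D. dyck_path D \<and> D \<noteq> []}"
      using dyck_path_first_return[of l r] by (simp add: first_return_def)
  next
    fix D assume "D \<in> {D. dyck_path D \<and> D \<noteq> []}"
    then obtain l r where "dyck_path l" "dyck_path r" "D = first_return (l, r)"
      using first_return_surj[of D] by auto
    then show "D \<in> first_return ` ({D. dyck_path D} \<times> {D. dyck_path D})"
      by (intro image_eqI[of _ _ "(l, r)"]) auto
  qed
qed

text \<open>If \<open>l\<close> is empty, the two outer steps meet in a peak of height 1; otherwise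
  no junction is a peak, as non-empty Dyck paths begin with \<open>Up\<close> and end with
  \<open>Down\<close>.\<close>

lemma peak_sum_first_return:
  assumes "dyck_path l" "dyck_path r"
  shows "peak_sum \<phi> (first_return (l, r)) =
    (if l = [] then \<phi> 1 else peak_sum (\<lambda>y. \<phi> (1 + y)) l) + peak_sum \<phi> r"
proof -
  have r: "r \<noteq> [] \<Longrightarrow> hd r = Up" and l: "l \<noteq> [] \<Longrightarrow> hd l = Up \<and> last l = Down"
    using assms dyck_path_hd dyck_path_last by auto
  have hl: "height l (length l) = 0" using assms by (simp add: dyck_path_def)
  have eq: "first_return (l, r) = [Up] @ (l @ ([Down] @ r))" by (simp add: first_return_def)
  have h1: "height [x] (length [x]) = rise x" for x by simp
  show ?thesis
    unfolding eq peak_sum_append h1 hl using r l by (cases "l = []") auto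
qed

text \<open>The only junction that can be a valley is the return to the axis, when a non-empty
  \<open>r\<close> follows.\<close>

lemma valley_sum_first_return:
  assumes "dyck_path l" "dyck_path r"
  shows "valley_sum \<phi> (first_return (l, r)) =
    valley_sum (\<lambda>y. \<phi> (1 + y)) l + valley_sum \<phi> r + (if r = [] then 0 else \<phi> 0)"
proof -
  have r: "r \<noteq> [] \<Longrightarrow> hd r = Up" and l: "l \<noteq> [] \<Longrightarrow> hd l = Up \<and> last l = Down"
    using assms dyck_path_hd dyck_path_last by auto
  have hl: "height l (length l) = 0" using assms by (simp add: dyck_path_def)
  have eq: "first_return (l, r) = [Up] @ (l @ ([Down] @ r))" by (simp add: first_return_def)
  have h1: "height [x] (length [x]) = rise x" for x by simp
  show ?thesis
    unfolding eq valley_sum_append h1 hl using r l by (cases "l = []"; cases "r = []") auto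
qed

lemma dyck_stats:
  assumes "dyck_path D"
  shows "int (sump D) = peak_sum (\<lambda>y. y) D" "int (sumv D) = valley_sum (\<lambda>y. y) D"
    "valley_sum (\<lambda>_. 1) D = (if D = [] then 0 else int (nbp D) - 1)"
  using assms sump_eq sumv_eq valleys_eq_peaks[of D] dyck_path_hd[OF assms] dyck_path_last[OF assms]
  by (auto simp: dyck_path_def nbp_eq)

text \<open>Lifting a non-empty \<open>l\<close> adds its \<open>nbp l\<close> peaks to
  \<open>sump\<close> but only its \<open>nbp l - 1\<close> valleys to \<open>sumv\<close>. The
  \<open>1 +\<close> makes up for this and becomes the factor \<open>v\<close> of the functional
  equation.\<close>

lemma stats_first_return:
  assumes "dyck_path l" "dyck_path r"
  shows "nbp (first_return (l, r)) = (if l = [] then 1 else nbp l) + nbp r"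
    and "sump (first_return (l, r)) = (if l = [] then 1 else sump l + nbp l) + sump r"
    and "1 + sumv (first_return (l, r)) = (if l = [] then 1 else sumv l + nbp l) + sumv r"
proof -
  note stats = dyck_stats[OF assms(1)] dyck_stats[OF assms(2)]
    dyck_stats(1,2)[OF dyck_path_first_return[OF assms]]
  note sums = peak_sum_first_return[OF assms] valley_sum_first_return[OF assms]
    peak_sum_add valley_sum_add
  show "nbp (first_return (l, r)) = (if l = [] then 1 else nbp l) + nbp r"
    using nbp_eq[of "first_return (l, r)"] nbp_eq[of l] nbp_eq[of r] by (auto simp: sums)
  show "sump (first_return (l, r)) = (if l = [] then 1 else sump l + nbp l) + sump r"
    using stats nbp_eq[of l] by (auto simp: sums)
  show "1 + sumv (first_return (l, r)) = (if l = [] then 1 else sumv l + nbp l) + sumv r"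
    using stats by (auto simp: sums)
qed

section \<open>The functional equation\<close>

definition dyck_shifted :: "nat \<Rightarrow> series" where
  "dyck_shifted j = genfun {D. dyck_path D} nbp (\<lambda>D. sump D + j * nbp D) (\<lambda>D. sumv D + j * nbp D)"

lemma stats_Nil [simp]: "nbp [] = 0" "sump [] = 0" "sumv [] = 0"
  by (simp_all add: nbp_def sump_def sumv_def peaks_def valleys_def)

text \<open>Fixing \<open>nbp D = a\<close> forces \<open>sump D = b - j * a\<close>, which reduces
  the claim to \<open>finite_dyck\<close>.\<close>

lemma finite_dyck_shifted:
  "finite {D \<in> {D. dyck_path D \<and> D \<noteq> []}. nbp D = a \<and> sump D + j * nbp D = b}"
  "finite {D \<in> {D. dyck_path D}. nbp D = a \<and> sump D + j * nbp D = b}"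
proof -
  show *: "finite {D \<in> {D. dyck_path D \<and> D \<noteq> []}. nbp D = a \<and> sump D + j * nbp D = b}"
    by (rule finite_subset[OF _ finite_dyck[of a "b - j * a"]]) auto
  show "finite {D \<in> {D. dyck_path D}. nbp D = a \<and> sump D + j * nbp D = b}"
    by (rule finite_subset[OF _ finite.insertI[OF *, of "[]"]]) auto
qed

lemma insert_Nil_dyck: "{D. dyck_path D} = insert [] {D. dyck_path D \<and> D \<noteq> []}"
  by auto

lemma dyck_shifted_eq:
  "dyck_shifted j = 1 + genfun {D. dyck_path D \<and> D \<noteq> []} nbp
     (\<lambda>D. sump D + j * nbp D) (\<lambda>D. sumv D + j * nbp D)"
  unfolding dyck_shifted_def insert_Nil_dyck
  by (subst genfun_insert) (use finite_dyck_shifted(1) in auto)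

lemma dyck_shifted_rec:
  "dyck_shifted j * (1 + var_v - cterm (Suc j) - dyck_shifted (Suc j)) = var_v"
proof -
  let ?W = "{D. dyck_path D}" and ?N = "{D. dyck_path D \<and> D \<noteq> []}"
  \<comment> \<open>These are the exponents contributed by \<open>l\<close>. An empty
    \<open>l\<close> stands for a peak of height 1 with shift \<open>j\<close>, hence the monomial
    \<open>cterm (Suc j)\<close>; a non-empty \<open>l\<close> is lifted by one, hence the shift
    \<open>Suc j\<close>.\<close>
  let ?f = "\<lambda>l. if l = [] then 1 else nbp l"
    and ?g = "\<lambda>l. if l = [] then Suc j else sump l + Suc j * nbp l"
    and ?h = "\<lambda>l. if l = [] then Suc j else sumv l + Suc j * nbp l"
  let ?F = "genfun ?N nbp (\<lambda>D. sump D + j * nbp D) (\<lambda>D. sumv D + j * nbp D)"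
  have fin: "finite {l \<in> ?N. ?f l = a \<and> ?g l = b}" for a b
    by (rule finite_subset[OF _ finite_dyck_shifted(1)[of a "Suc j" b]]) auto
  have fin': "finite {l \<in> ?W. ?f l = a \<and> ?g l = b}" for a b
    by (rule finite_subset[OF _ finite.insertI[OF fin[of a b], of "[]"]]) auto
  have "genfun ?W ?f ?g ?h = cterm (Suc j) + genfun ?N ?f ?g ?h"
    unfolding insert_Nil_dyck using fin by (subst genfun_insert) (auto simp: cterm_def)
  also have "genfun ?N ?f ?g ?h = dyck_shifted (Suc j) - 1"
    unfolding dyck_shifted_eq by (simp, rule genfun_cong) simp
  finally have H: "genfun ?W ?f ?g ?h = cterm (Suc j) + dyck_shifted (Suc j) - 1"
    by simp
  \<comment> \<open>With this factor all exponents become additive over the pair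
    \<open>(l, r)\<close>.\<close>
  have "var_v * ?F = genfun ?N nbp (\<lambda>D. sump D + j * nbp D) (\<lambda>D. 1 + (sumv D + j * nbp D))"
    by (rule var_v_times_genfun)
  also have "\<dots> = genfun (?W \<times> ?W) (\<lambda>(l, r). ?f l + nbp r)
      (\<lambda>(l, r). ?g l + (sump r + j * nbp r)) (\<lambda>(l, r). ?h l + (sumv r + j * nbp r))"
  proof (rule genfun_reindex[OF bij_first_return])
    fix z assume "z \<in> ?W \<times> ?W"
    then obtain l r where z: "z = (l, r)" "dyck_path l" "dyck_path r" by auto
    note stats = stats_first_return[OF z(2,3)]
    show "nbp (first_return z) = (\<lambda>(l, r). ?f l + nbp r) z"
      using stats z by simp
    show "sump (first_return z) + j * nbp (first_return z) =
        (\<lambda>(l, r). ?g l + (sump r + j * nbp r)) z"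
      using stats z by (simp add: algebra_simps)
    have "1 + (sumv (first_return z) + j * nbp (first_return z)) =
        (1 + sumv (first_return z)) + j * nbp (first_return z)" by simp
    then show "1 + (sumv (first_return z) + j * nbp (first_return z)) =
        (\<lambda>(l, r). ?h l + (sumv r + j * nbp r)) z"
      unfolding z(1) stats by (cases "l = []") (simp_all add: algebra_simps)
  qed
  also have "\<dots> = genfun ?W ?f ?g ?h * dyck_shifted j"
    unfolding dyck_shifted_def
    by (rule genfun_times[symmetric, OF fin' finite_dyck_shifted(2)])
  finally have "var_v * (dyck_shifted j - 1) =
      (cterm (Suc j) + dyck_shifted (Suc j) - 1) * dyck_shifted j"
    unfolding H by (simp add: dyck_shifted_eq[of j])
  then show ?thesis by (simp add: algebra_simps)
qed

text \<open>\<open>sump D\<close> exceeds \<open>sumv D\<close> by the semilength, so the exponent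
  of \<open>v\<close> never exceeds that of \<open>q\<close>.\<close>

lemma vdeg_le_dyck_shifted: "vdeg_le 0 (dyck_shifted j)"
  unfolding vdeg_le_def
proof (intro allI)
  fix a b
  have "sumv D + j * nbp D \<le> b" if "dyck_path D" "sump D + j * nbp D = b" for D
    using that sump_eq_semilength_plus_sumv[of D] by simp
  then have "vanishes_below (0 - int b) (fls_X_inv ^ (sumv D + j * nbp D))"
    if "dyck_path D" "sump D + j * nbp D = b" for D
    unfolding vanishes_below_def using that by fastforce
  then show "vanishes_below (0 - int b) (dyck_shifted j $ a $ b)"
    unfolding dyck_shifted_def genfun_nth by (intro vanishes_below_sum) blast
qed

lemma cfrac_converges_A_dyck:
  "(\<lambda>n. (- 1 + cfrac var_p var_q var_v 1 n) $ a $ b) \<longlonglongrightarrow> A_dyck $ a $ b"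
proof (rule tendsto_fls_if_vanishes_below)
  fix n
  have "dyck_shifted 0 = 1 + A_dyck"
    by (simp add: dyck_shifted_eq A_dyck_def)
  \<comment> \<open>Shift 0 corresponds to the fraction whose denominators start at index 1.\<close>
  then have "vdeg_le (int n) (- 1 + cfrac var_p var_q var_v 1 n - A_dyck)"
    using cfrac_error[OF dyck_shifted_rec vdeg_le_dyck_shifted, of n 0]
    by (simp add: algebra_simps)
  then show "vanishes_below (int n - int b)
      ((- 1 + cfrac var_p var_q var_v 1 n) $ a $ b - A_dyck $ a $ b)"
    unfolding vdeg_le_def fps_sub_nth by blast
qed

section \<open>Dyck paths and Stanley polyominoes\<close>

definition word :: "(nat \<times> nat) list \<Rightarrow> step list" where
  "word xs = concat (map (\<lambda>(x, y). replicate x Up @ replicate y Down) xs)"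

definition ups :: "(nat \<times> nat) list \<Rightarrow> nat \<Rightarrow> int" where
  "ups xs i = int (sum_list (map fst (take i xs)))"

definition downs :: "(nat \<times> nat) list \<Rightarrow> nat \<Rightarrow> int" where
  "downs xs i = int (sum_list (map snd (take i xs)))"

definition positive_runs :: "(nat \<times> nat) list \<Rightarrow> bool" where
  "positive_runs xs \<longleftrightarrow> (\<forall>(x, y)\<in>set xs. x \<ge> 1 \<and> y \<ge> 1)"

definition dyck_runs :: "(nat \<times> nat) list \<Rightarrow> bool" where
  "dyck_runs xs \<longleftrightarrow> xs \<noteq> [] \<and> positive_runs xs \<and> (\<forall>i\<le>length xs. downs xs i \<le> ups xs i) \<and>
     ups xs (length xs) = downs xs (length xs)"

lemma word_Nil [simp]: "word [] = []"
  by (simp add: word_def)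

lemma word_Cons [simp]: "word ((x, y) # xs) = replicate x Up @ replicate y Down @ word xs"
  by (simp add: word_def)

lemma word_snoc [simp]: "word (xs @ [(x, y)]) = word xs @ replicate x Up @ replicate y Down"
  by (simp add: word_def)

lemma ups_downs_0 [simp]: "ups xs 0 = 0" "downs xs 0 = 0"
  by (simp_all add: ups_def downs_def)

lemma ups_downs_Suc:
  "i < length xs \<Longrightarrow> ups xs (Suc i) = ups xs i + int (fst (xs ! i))"
  "i < length xs \<Longrightarrow> downs xs (Suc i) = downs xs i + int (snd (xs ! i))"
  by (simp_all add: ups_def downs_def take_Suc_conv_app_nth)

lemma ups_downs_append [simp]:
  "i \<le> length xs \<Longrightarrow> ups (xs @ ys) i = ups xs i"
  "i \<le> length xs \<Longrightarrow> downs (xs @ ys) i = downs xs i"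
  by (simp_all add: ups_def downs_def)

lemma ups_downs_snoc [simp]:
  "ups (xs @ [(x, y)]) (Suc (length xs)) = ups xs (length xs) + int x"
  "downs (xs @ [(x, y)]) (Suc (length xs)) = downs xs (length xs) + int y"
  by (simp_all add: ups_def downs_def)

lemma positive_runs_simps [simp]:
  "positive_runs []"
  "positive_runs ((x, y) # xs) \<longleftrightarrow> x \<ge> 1 \<and> y \<ge> 1 \<and> positive_runs xs"
  "positive_runs (xs @ [(x, y)]) \<longleftrightarrow> x \<ge> 1 \<and> y \<ge> 1 \<and> positive_runs xs"
  by (auto simp: positive_runs_def)

lemma positive_runs_nth: "positive_runs xs \<Longrightarrow> i < length xs \<Longrightarrow> fst (xs ! i) \<ge> 1 \<and> snd (xs ! i) \<ge> 1"
  unfolding positive_runs_def using nth_mem by fastforce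

lemma hd_word: "positive_runs xs \<Longrightarrow> xs \<noteq> [] \<Longrightarrow> word xs \<noteq> [] \<and> hd (word xs) = Up"
  by (cases xs) (auto simp: hd_append)

lemma last_word: "positive_runs xs \<Longrightarrow> xs \<noteq> [] \<Longrightarrow> last (word xs) = Down"
  by (cases xs rule: rev_cases) auto

lemma height_replicate: "i \<le> n \<Longrightarrow> height (replicate n a) i = int i * rise a"
  by (simp add: height_def min_def sum_list_replicate)

lemma height_run:
  "height (replicate x Up @ replicate y Down) i =
    (if i \<le> x then int i else 2 * int x - int i)" if "i \<le> x + y"
  using that by (simp add: height_append height_replicate of_nat_diff)

lemma height_word: "height (word xs) (length (word xs)) = ups xs (length xs) - downs xs (length xs)"
proof (induction xs rule: rev_induct)
  case (snoc z xs)
  obtain x y where z: "z = (x, y)" by (cases z)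
  show ?case
    unfolding z word_snoc length_append[of "word xs"] height_append_right snoc
    by (simp add: height_run)
qed simp

lemma peak_sum_replicate [simp]: "peak_sum \<phi> (replicate n a) = 0"
  by (auto simp: peak_sum_def peaks_def intro!: sum.neutral)

lemma valley_sum_replicate [simp]: "valley_sum \<phi> (replicate n a) = 0"
  by (auto simp: valley_sum_def valleys_def intro!: sum.neutral)

text \<open>Each block has exactly one peak, after its own ascent but before its own descent, hence
  the indices \<open>Suc j\<close> and \<open>j\<close>.\<close>

lemma peak_sum_word:
  "positive_runs xs \<Longrightarrow> peak_sum \<phi> (word xs) = (\<Sum>j<length xs. \<phi> (ups xs (Suc j) - downs xs j))"
proof (induction xs rule: rev_induct)
  case (snoc z xs)
  obtain x y where z: "z = (x, y)" by (cases z)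
  have "x \<ge> 1" "y \<ge> 1" "positive_runs xs" using snoc.prems z by auto
  moreover have "(\<Sum>j<length xs. \<phi> (ups (xs @ [z]) (Suc j) - downs (xs @ [z]) j)) =
      (\<Sum>j<length xs. \<phi> (ups xs (Suc j) - downs xs j))"
    by (intro sum.cong) auto
  ultimately show ?case
    using snoc.IH last_word[of xs]
    by (simp add: z peak_sum_append height_word height_replicate add_diff_eq diff_add_eq)
qed simp

text \<open>Valleys sit exactly between consecutive blocks, so block 0 has none before it.\<close>

lemma valley_sum_word:
  "positive_runs xs \<Longrightarrow> valley_sum \<phi> (word xs) = (\<Sum>j\<in>{1..<length xs}. \<phi> (ups xs j - downs xs j))"
proof (induction xs rule: rev_induct)
  case (snoc z xs)
  obtain x y where z: "z = (x, y)" by (cases z)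
  have p: "x \<ge> 1" "y \<ge> 1" "positive_runs xs" using snoc.prems z by auto
  have *: "(\<Sum>j\<in>{1..<length xs}. \<phi> (ups (xs @ [z]) j - downs (xs @ [z]) j)) =
      (\<Sum>j\<in>{1..<length xs}. \<phi> (ups xs j - downs xs j))"
    by (intro sum.cong) auto
  show ?case
  proof (cases "xs = []")
    case False
    then have "{1..<length (xs @ [z])} = insert (length xs) {1..<length xs}" by (cases xs) auto
    then show ?thesis
      using snoc.IH p * False last_word[of xs] hd_word[of xs]
      by (simp add: z valley_sum_append height_word height_replicate hd_append)
  qed (use p in \<open>simp add: z valley_sum_append\<close>)
qed simp

text \<open>One half of \<open>dyck_path\<close>, isolated because it passes to prefixes that end
  above the axis, as induction over blocks requires.\<close>

definition nonneg :: "step list \<Rightarrow> bool" where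
  "nonneg D \<longleftrightarrow> (\<forall>i\<le>length D. height D i \<ge> 0)"

lemma nonneg_append:
  "nonneg (A @ B) \<longleftrightarrow> nonneg A \<and> (\<forall>i\<le>length B. height A (length A) + height B i \<ge> 0)"
  (is "?L \<longleftrightarrow> ?R")
proof
  assume L: ?L
  have "height (A @ B) i \<ge> 0" if "i \<le> length A + length B" for i
    using L that by (simp add: nonneg_def)
  then show ?R
    unfolding nonneg_def
    by (metis add_le_cancel_left height_append height_append_right trans_le_add1)
next
  assume R: ?R
  show ?L
    unfolding nonneg_def
  proof (intro allI impI)
    fix i assume "i \<le> length (A @ B)"
    then show "height (A @ B) i \<ge> 0"
      using R by (auto simp: height_append nonneg_def)
  qed
qed

text \<open>Within a block the height rises and then falls, so it is smallest at an end of the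
  block.\<close>

lemma nonneg_word: "nonneg (word xs) \<longleftrightarrow> (\<forall>i\<le>length xs. downs xs i \<le> ups xs i)"
proof (induction xs rule: rev_induct)
  case Nil
  then show ?case by (simp add: nonneg_def)
next
  case (snoc z xs)
  obtain x y where z: "z = (x, y)" by (cases z)
  let ?h = "ups xs (length xs) - downs xs (length xs)"
  have "(\<forall>i\<le>x + y. ?h + height (replicate x Up @ replicate y Down) i \<ge> 0) \<longleftrightarrow>
      ?h + int x - int y \<ge> 0" if "?h \<ge> 0"
  proof
    assume "\<forall>i\<le>x + y. ?h + height (replicate x Up @ replicate y Down) i \<ge> 0"
    from this[rule_format, of "x + y"] show "?h + int x - int y \<ge> 0"
      by (auto simp: height_run split: if_splits)
  next
    assume "?h + int x - int y \<ge> 0"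
    then show "\<forall>i\<le>x + y. ?h + height (replicate x Up @ replicate y Down) i \<ge> 0"
      using that by (auto simp: height_run)
  qed
  moreover have "(\<forall>i\<le>Suc (length xs). downs (xs @ [z]) i \<le> ups (xs @ [z]) i) \<longleftrightarrow>
      (\<forall>i\<le>length xs. downs xs i \<le> ups xs i) \<and> ?h + int x - int y \<ge> 0"
    by (auto simp: le_Suc_eq z)
  ultimately show ?case
    unfolding z word_snoc nonneg_append height_word snoc by (auto simp: z)
qed

lemma dyck_path_word:
  assumes "positive_runs xs" "xs \<noteq> []"
  shows "dyck_path (word xs) \<longleftrightarrow> dyck_runs xs"
  using nonneg_word[of xs] assms by (auto simp: dyck_path_def dyck_runs_def height_word nonneg_def)

text \<open>The conditions on \<open>hd\<close> make the leading run maximal, so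
  \<open>takeWhile\<close> recovers it.\<close>

lemma replicate_append_inj:
  assumes "replicate x a @ V = replicate x' a @ V'"
    and "V \<noteq> [] \<Longrightarrow> hd V \<noteq> a" "V' \<noteq> [] \<Longrightarrow> hd V' \<noteq> a"
  shows "x = x' \<and> V = V'"
proof -
  have t: "takeWhile (\<lambda>z. z = a) (replicate n a @ U) = replicate n a"
    if "U \<noteq> [] \<Longrightarrow> hd U \<noteq> a" for n U
    using that by (induction n) (cases U; auto)+
  have "replicate x a = replicate x' a"
    using t[of V x] t[of V' x'] assms by metis
  then have "x = x'" by (metis length_replicate)
  then show ?thesis using assms(1) by simp
qed

lemma word_inj: "positive_runs xs \<Longrightarrow> positive_runs ys \<Longrightarrow> word xs = word ys \<Longrightarrow> xs = ys"
proof (induction xs arbitrary: ys)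
  case Nil
  then show ?case using hd_word[of ys] by auto
next
  case (Cons z xs)
  obtain x y where z: "z = (x, y)" by (cases z)
  have "ys \<noteq> []" using Cons.prems hd_word[of "z # xs"] by auto
  then obtain x' y' ys' where ys: "ys = (x', y') # ys'" by (metis list.exhaust prod.exhaust)
  have p: "x \<ge> 1" "y \<ge> 1" "positive_runs xs" "x' \<ge> 1" "y' \<ge> 1" "positive_runs ys'"
    using Cons.prems by (auto simp: z ys)
  have 1: "x = x' \<and> replicate y Down @ word xs = replicate y' Down @ word ys'"
    by (rule replicate_append_inj) (use Cons.prems p in \<open>auto simp: z ys hd_append\<close>)
  have "y = y' \<and> word xs = word ys'"
    by (rule replicate_append_inj[of y Down])
      (use 1 p hd_word[of xs] hd_word[of ys'] in \<open>cases "xs = []"; cases "ys' = []"; auto\<close>)+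
  then show ?case using 1 Cons.IH p by (auto simp: z ys)
qed

text \<open>The trailing \<open>Up\<close> steps are a block still waiting for its descent, which
  makes the claim inductive under appending a step.\<close>

lemma word_surj:
  "(D \<noteq> [] \<Longrightarrow> hd D = Up) \<Longrightarrow> \<exists>xs x. positive_runs xs \<and> D = word xs @ replicate x Up"
proof (induction D rule: rev_induct)
  case Nil
  show ?case by (intro exI[of _ "[]"] exI[of _ 0]) simp
next
  case (snoc a D)
  then obtain xs x where D: "positive_runs xs" "D = word xs @ replicate x Up"
    by (metis append_is_Nil_conv hd_append)
  show ?case
  proof (cases a)
    case Up
    then show ?thesis
      using D by (intro exI[of _ xs] exI[of _ "Suc x"]) (simp add: replicate_append_same)
  next
    case Down
    show ?thesis
    proof (cases "x = 0")
      case True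
      \<comment> \<open>Otherwise the path would start with this \<open>Down\<close>. The step
        therefore prolongs the descent of an existing last block.\<close>
      then have "xs \<noteq> []" using snoc.prems D Down by auto
      then obtain ys u w where "xs = ys @ [(u, w)]" by (metis rev_exhaust prod.exhaust)
      then show ?thesis
        using D True Down
        by (intro exI[of _ "ys @ [(u, Suc w)]"] exI[of _ 0]) (simp add: replicate_append_same)
    next
      case False
      then show ?thesis
        using D Down by (intro exI[of _ "xs @ [(x, 1)]"] exI[of _ 0]) simp
    qed
  qed
qed

lemma bij_word: "bij_betw word {xs. dyck_runs xs} {D. dyck_path D \<and> D \<noteq> []}"
  unfolding bij_betw_def
proof (intro conjI)
  show "inj_on word {xs. dyck_runs xs}"
    using word_inj by (auto simp: inj_on_def dyck_runs_def)
  show "word ` {xs. dyck_runs xs} = {D. dyck_path D \<and> D \<noteq> []}"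
  proof (intro equalityI subsetI)
    fix D assume "D \<in> word ` {xs. dyck_runs xs}"
    then show "D \<in> {D. dyck_path D \<and> D \<noteq> []}"
      using dyck_path_word hd_word by (auto simp: dyck_runs_def)
  next
    fix D assume "D \<in> {D. dyck_path D \<and> D \<noteq> []}"
    then have D: "dyck_path D" "D \<noteq> []" by auto
    obtain xs x where xs: "positive_runs xs" "D = word xs @ replicate x Up"
      using word_surj[of D] dyck_path_hd[OF D] by auto
    then have "x = 0" using dyck_path_last[OF D] by (cases "x = 0") auto
    then have "D = word xs" "xs \<noteq> []" using xs D by auto
    then show "D \<in> word ` {xs. dyck_runs xs}"
      using dyck_path_word[OF xs(1)] D by auto
  qed
qed

section \<open>The bijection with Stanley polyominoes\<close>

definition polyomino :: "(nat \<times> nat) list \<Rightarrow> cell set" where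
  "polyomino xs = cells (length xs) (downs xs) (\<lambda>j. ups xs (Suc j))"

text \<open>Positive runs give the strict inequalities, and non-negative valley heights give the
  overlap of consecutive rows.\<close>

lemma stanley_rows_runs:
  assumes "dyck_runs xs"
  shows "stanley_rows (length xs) (downs xs) (\<lambda>j. ups xs (Suc j))"
  unfolding stanley_rows_def
proof (intro conjI allI impI)
  show "length xs \<ge> 1" using assms by (cases xs) (auto simp: dyck_runs_def)
  fix j
  have le: "downs xs i \<le> ups xs i" if "i \<le> length xs" for i
    using assms that by (simp add: dyck_runs_def)
  have pos: "fst (xs ! i) \<ge> 1 \<and> snd (xs ! i) \<ge> 1" if "i < length xs" for i
    using assms positive_runs_nth that by (auto simp: dyck_runs_def)
  show "downs xs j \<le> ups xs (Suc j)" if "j < length xs"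
    using le[of j] that by (simp add: ups_downs_Suc)
  assume j: "1 \<le> j \<and> j < length xs"
  then obtain i where i: "j = Suc i" by (cases j) auto
  show "downs xs (j - 1) < downs xs j" "downs xs j \<le> ups xs (Suc (j - 1))"
    "ups xs (Suc (j - 1)) < ups xs (Suc j)"
    using i j pos[of i] pos[of j] le[of j] by (simp_all add: ups_downs_Suc)
qed

lemma cells_row:
  assumes "j < k"
  shows "{i. (i, int j) \<in> cells k s e} = {s j..e j}"
  using assms by (auto simp: cells_def)

text \<open>Rows are non-empty intervals and so determine their end points.\<close>

lemma cells_inj:
  assumes "stanley_rows k s e" "stanley_rows k' s' e'" "cells k s e = cells k' s' e'"
  shows "k = k' \<and> (\<forall>j<k. s j = s' j \<and> e j = e' j)"
proof -
  have k: "k = k'" using row_stanley[OF assms(1)] row_stanley[OF assms(2)] assms(3) by simp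
  have "s j = s' j \<and> e j = e' j" if "j < k" for j
  proof -
    have "{i. (i, int j) \<in> cells k s e} = {i. (i, int j) \<in> cells k' s' e'}"
      by (simp only: assms(3))
    then have "{s j..e j} = {s' j..e' j}"
      using that k by (simp only: cells_row)
    then show ?thesis
      using assms(1) that by (auto simp: stanley_rows_def Icc_eq_Icc)
  qed
  then show ?thesis using k by blast
qed

lemma cells_cong:
  "(\<And>j. j < k \<Longrightarrow> s j = s' j \<and> e j = e' j) \<Longrightarrow> cells k s e = cells k s' e'"
  unfolding cells_def by (metis (no_types, opaque_lifting))

text \<open>The rows determine all partial sums except the total of the descents, which equals the
  total of the ascents.\<close>

lemma polyomino_inj:
  assumes "dyck_runs xs" "dyck_runs ys" "polyomino xs = polyomino ys"
  shows "xs = ys"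
proof -
  have len: "length xs = length ys"
    and eq: "\<And>j. j < length xs \<Longrightarrow> downs xs j = downs ys j \<and> ups xs (Suc j) = ups ys (Suc j)"
    using cells_inj[OF stanley_rows_runs[OF assms(1)] stanley_rows_runs[OF assms(2)]] assms(3)
    by (auto simp: polyomino_def)
  have u: "ups xs j = ups ys j" if "j \<le> length xs" for j
    using eq[of "j - 1"] that by (cases j) auto
  have d: "downs xs j = downs ys j" if "j \<le> length xs" for j
  proof (cases "j = length xs")
    case True
    then show ?thesis using assms(1,2) u[of j] len by (simp add: dyck_runs_def)
  qed (use eq that in simp)
  show ?thesis
  proof (rule nth_equalityI[OF len])
    fix i assume "i < length xs"
    then show "xs ! i = ys ! i"
      using u[of i] u[of "Suc i"] d[of i] d[of "Suc i"] len
      by (simp add: ups_downs_Suc prod_eq_iff)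
  qed
qed

lemma polyomino_surj:
  assumes P: "stanley_polyomino P" "col P \<ge> 2"
  shows "\<exists>xs. dyck_runs xs \<and> P = polyomino xs"
proof -
  obtain k s e where k: "stanley_rows k s e" "s 0 = 0" "P = cells k s e"
    using P by (auto simp: stanley_polyomino_def)
  have k1: "k \<ge> 1" using k by (simp add: stanley_rows_def)
  have step: "s i < s (Suc i) \<and> s (Suc i) \<le> e i \<and> e i < e (Suc i)" if "Suc i < k" for i
    using k(1) that unfolding stanley_rows_def by (metis diff_Suc_1 le_add1 plus_1_eq_Suc)
  have "e (k - 1) \<ge> 1" using col_stanley[OF k(1)] k P by simp
  \<comment> \<open>For one row this is the condition on columns; otherwise row 1 starts right of
    abscissa 0 and overlaps row 0.\<close>
  then have e0: "e 0 \<ge> 1" using step[of 0] k(2) k1 by (cases "k = 1") auto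
  have se: "s j < e j" if "j < k" for j
    using step[of "j - 1"] step[of j] e0 k(2) that by (cases j) auto
  \<comment> \<open>\<open>E\<close> and \<open>S\<close> are the intended partial sums: the row
    ends preceded by 0, and the row starts followed by the last row end, so that both totals agree.
    The last descent is positive by \<open>se\<close>.\<close>
  define E where "E j = (if j = 0 then 0 else e (j - 1))" for j
  define S where "S j = (if j < k then s j else e (j - 1))" for j
  define xs where "xs = map (\<lambda>j. (nat (E (Suc j) - E j), nat (S (Suc j) - S j))) [0..<k]"
  have len: "length xs = k" by (simp add: xs_def)
  have E: "E j < E (Suc j)" if "j < k" for j
    using step[of "j - 1"] e0 that by (cases j) (auto simp: E_def)
  have S: "S j < S (Suc j)" if "j < k" for j
    using step[of j] se[of j] that by (auto simp: S_def)
  have nth: "xs ! j = (nat (E (Suc j) - E j), nat (S (Suc j) - S j))" if "j < k" for j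
    using that by (simp add: xs_def)
  have u: "ups xs j = E j" if "j \<le> k" for j
    using that
  proof (induction j)
    case (Suc j)
    then show ?case using E[of j] nth[of j] len by (simp add: ups_downs_Suc)
  qed (simp add: E_def)
  have d: "downs xs j = S j" if "j \<le> k" for j
    using that
  proof (induction j)
    case (Suc j)
    then show ?case using S[of j] nth[of j] len by (simp add: ups_downs_Suc)
  qed (use k k1 in \<open>simp add: S_def\<close>)
  have "positive_runs xs" using E S by (force simp: xs_def positive_runs_def)
  moreover have "S j \<le> E j" if "j \<le> k" for j
    using that step[of "j - 1"] k(2) k1 by (cases j) (auto simp: S_def E_def)
  moreover have "S k = E k" using k1 by (simp add: S_def E_def)
  ultimately have "dyck_runs xs"
    using u d len k1 by (auto simp: dyck_runs_def)
  moreover have "P = polyomino xs"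
    unfolding k(3) polyomino_def len by (rule cells_cong) (simp add: u d S_def E_def)
  ultimately show ?thesis by blast
qed

lemma bij_polyomino:
  "bij_betw polyomino {xs. dyck_runs xs} {P. stanley_polyomino P \<and> col P \<ge> 2}"
  unfolding bij_betw_def
proof (intro conjI)
  show "inj_on polyomino {xs. dyck_runs xs}"
    using polyomino_inj by (auto simp: inj_on_def)
  show "polyomino ` {xs. dyck_runs xs} = {P. stanley_polyomino P \<and> col P \<ge> 2}"
  proof (intro equalityI subsetI)
    fix P assume "P \<in> polyomino ` {xs. dyck_runs xs}"
    then obtain xs where xs: "dyck_runs xs" "P = polyomino xs" by auto
    note rows = stanley_rows_runs[OF xs(1)]
    have "stanley_polyomino P"
      unfolding stanley_polyomino_def xs(2) polyomino_def using rows ups_downs_0(2) by blast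
    moreover obtain n where n: "length xs = Suc n"
      using xs(1) by (cases xs) (auto simp: dyck_runs_def)
    then have "ups xs (Suc n) \<ge> 1"
      using xs(1) positive_runs_nth[of xs n] by (auto simp: ups_downs_Suc dyck_runs_def ups_def[of _ n])
    then have "col P \<ge> 2"
      using col_stanley[OF rows] n by (simp add: xs(2) polyomino_def)
    ultimately show "P \<in> {P. stanley_polyomino P \<and> col P \<ge> 2}" by simp
  next
    fix P assume "P \<in> {P. stanley_polyomino P \<and> col P \<ge> 2}"
    then show "P \<in> polyomino ` {xs. dyck_runs xs}" using polyomino_surj by blast
  qed
qed

section \<open>Area and interior points\<close>

lemma area_cells:
  assumes "stanley_rows k s e"
  shows "int (area (cells k s e)) = (\<Sum>j<k. e j - s j + 1)"
proof -
  have "cells k s e = (\<Union>j<k. {s j..e j} \<times> {int j})" by (auto simp: cells_def)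
  then have "area (cells k s e) = (\<Sum>j<k. card ({s j..e j} \<times> {int j}))"
    unfolding area_def by (simp only:) (rule card_UN_disjoint, auto)
  also have "int \<dots> = (\<Sum>j<k. e j - s j + 1)"
    unfolding of_nat_sum using assms by (intro sum.cong) (auto simp: stanley_rows_def)
  finally show ?thesis .
qed

text \<open>Only the four cells around \<open>(x, y)\<close> contain that point.\<close>

lemma card_window_eq_4:
  fixes P :: "cell set" and x y :: int
  shows "card {(i, j) \<in> P. x \<in> {i..i+1} \<and> y \<in> {j..j+1}} = 4 \<longleftrightarrow>
    {(x - 1, y - 1), (x - 1, y), (x, y - 1), (x, y)} \<subseteq> P"
proof -
  let ?Q = "{(x - 1, y - 1), (x - 1, y), (x, y - 1), (x, y)}"
  have "{(i, j) \<in> P. x \<in> {i..i+1} \<and> y \<in> {j..j+1}} = P \<inter> ?Q"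
    by (auto; presburger)
  moreover have "card (P \<inter> ?Q) = 4 \<longleftrightarrow> ?Q \<subseteq> P"
  proof
    assume "card (P \<inter> ?Q) = 4"
    then have "P \<inter> ?Q = ?Q" by (intro card_subset_eq) (auto simp: card_insert_if)
    then show "?Q \<subseteq> P" by blast
  next
    assume "?Q \<subseteq> P"
    then have "P \<inter> ?Q = ?Q" by blast
    then show "card (P \<inter> ?Q) = 4" by (simp only:) (simp add: card_insert_if)
  qed
  ultimately show ?thesis by simp
qed

text \<open>An interior point at ordinate \<open>j\<close> has both neighbouring cells in rows
  \<open>j - 1\<close> and \<open>j\<close>. As starts and ends increase, the binding conditions are
  the start of row \<open>j\<close> and the end of row \<open>j - 1\<close>.\<close>

lemma point_cells:
  assumes "stanley_rows k s e"
  shows "int (point (cells k s e)) = (\<Sum>j\<in>{1..<k}. e (j - 1) - s j)"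
proof -
  have step: "s (j - 1) < s j \<and> s j \<le> e (j - 1) \<and> e (j - 1) < e j" if "1 \<le> j" "j < k" for j
    using assms that by (simp add: stanley_rows_def)
  have mem: "(i, y) \<in> cells k s e \<longleftrightarrow> y \<ge> 0 \<and> nat y < k \<and> s (nat y) \<le> i \<and> i \<le> e (nat y)" for i y
    unfolding cells_def by (auto intro: exI[of _ "nat y"])
  have "(x, y) \<in> {(x, y). card {(i, j) \<in> cells k s e. x \<in> {i..i+1} \<and> y \<in> {j..j+1}} = 4} \<longleftrightarrow>
      (x, y) \<in> (\<Union>j\<in>{1..<k}. {s j + 1..e (j - 1)} \<times> {int j})" (is "?L \<longleftrightarrow> ?R") for x y
  proof -
    have st: "s (nat y - Suc 0) < s (nat y) \<and> e (nat y - Suc 0) < e (nat y)"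
      if "y \<ge> 1" "nat y < k"
      using step[of "nat y"] that by simp
    have "?L \<longleftrightarrow> {(x - 1, y - 1), (x - 1, y), (x, y - 1), (x, y)} \<subseteq> cells k s e"
      by (simp only: mem_Collect_eq prod.case card_window_eq_4)
    also have "\<dots> \<longleftrightarrow> y \<ge> 1 \<and> nat y < k \<and> s (nat y) + 1 \<le> x \<and> x \<le> e (nat y - 1)"
      using st by (auto simp: mem nat_diff_distrib)
    also have "\<dots> \<longleftrightarrow> ?R"
      by (auto intro!: bexI[of _ "nat y"])
    finally show ?thesis .
  qed
  then have "{(x, y). card {(i, j) \<in> cells k s e. x \<in> {i..i+1} \<and> y \<in> {j..j+1}} = 4} =
      (\<Union>j\<in>{1..<k}. {s j + 1..e (j - 1)} \<times> {int j})"
    by (simp add: set_eq_iff)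
  then have "point (cells k s e) = (\<Sum>j\<in>{1..<k}. card ({s j + 1..e (j - 1)} \<times> {int j}))"
    unfolding point_def by (simp only:) (rule card_UN_disjoint, auto)
  also have "int \<dots> = (\<Sum>j\<in>{1..<k}. e (j - 1) - s j)"
    unfolding of_nat_sum using step by (intro sum.cong) auto
  finally show ?thesis .
qed

text \<open>Both series are reindexed over lists of runs, where the statistics coincide.\<close>

lemma A_dyck_eq_A_stanley: "A_dyck = A_stanley"
proof -
  have stats: "row (polyomino xs) = nbp (word xs) \<and>
      area (polyomino xs) - row (polyomino xs) = sump (word xs) \<and>
      point (polyomino xs) = sumv (word xs)" if xs: "dyck_runs xs" for xs
  proof -
    note rows = stanley_rows_runs[OF xs]
    have pos: "positive_runs xs" and ne: "xs \<noteq> []" using xs by (auto simp: dyck_runs_def)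
    have dyck: "dyck_path (word xs)" using dyck_path_word[OF pos ne] xs by simp
    have row: "row (polyomino xs) = length xs"
      unfolding polyomino_def by (rule row_stanley[OF rows])
    have "int (nbp (word xs)) = int (length xs)"
      unfolding nbp_eq peak_sum_word[OF pos] by simp
    \<comment> \<open>The additive form over the integers avoids the truncated subtraction
      \<open>area - row\<close>.\<close>
    moreover have "int (area (polyomino xs)) = int (sump (word xs)) + int (length xs)"
      unfolding polyomino_def area_cells[OF rows] dyck_stats(1)[OF dyck] peak_sum_word[OF pos]
      by (simp add: sum.distrib)
    moreover have "int (point (polyomino xs)) = int (sumv (word xs))"
      unfolding polyomino_def point_cells[OF rows] dyck_stats(2)[OF dyck] valley_sum_word[OF pos]
      by (intro sum.cong) auto
    ultimately show ?thesis unfolding row by linarith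
  qed
  have "A_stanley = genfun {xs. dyck_runs xs} (\<lambda>xs. nbp (word xs)) (\<lambda>xs. sump (word xs)) (\<lambda>xs. sumv (word xs))"
    unfolding A_stanley_def by (rule genfun_reindex[OF bij_polyomino]) (use stats in blast)+
  moreover have "A_dyck = genfun {xs. dyck_runs xs} (\<lambda>xs. nbp (word xs)) (\<lambda>xs. sump (word xs)) (\<lambda>xs. sumv (word xs))"
    unfolding A_dyck_def by (rule genfun_reindex[OF bij_word]) auto
  ultimately show ?thesis by simp
qed

theorem theorem3p1:
  shows "A_dyck = A_stanley \<and>
    (\<forall>a b. (\<lambda>n. fps_nth (fps_nth (- 1 + cfrac var_p var_q var_v 1 n) a) b)
             \<longlonglongrightarrow> fps_nth (fps_nth A_dyck a) b)"
  using A_dyck_eq_A_stanley cfrac_converges_A_dyck by blast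

end
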